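(* Let $K$ be an imaginary quadratic number field with ring of integers $\mathcal{O}_K$. Suppose that $L$ is a free $\mathcal{O}_K$-module of finite rank, and $M\subset L$ is an $\mathcal{O}_K$-submodule with finite index $(L:M)<+\infty$. Then there is an integral $\mathcal{O}_K$-ideal $\mathcal{A}$ such that the ideal class $[\mathcal{A}]$ is the Steinitz class of $M$ and $N^K_{\mathbf{Q}}(\mathcal{A})=(L:M)$, where $N^K_{\mathbf{Q}}(\cdot)$ is the norm map of ideals from $K$ to $\mathbf{Q}$.
   Context: Steinitz class: a finitely generated module $M$ over $\mathcal{O}_K$ is isomorphic to $M_{tor}\oplus\mathcal{O}_K^{s-1}\oplus\mathcal{A}$ with $s$ the rank and $\mathcal{A}$ a nonzero ideal of $\mathcal{O}_K$ that is unique up to multiplication by an element of $K^\times$; the ideal class $[\mathcal{A}]$ is the Steinitz class $St(M)$ (taken to be trivial if $s=0$). $(L:M)$ denotes the index as abelian groups. *)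

theory Defs
  imports
    "HOL-Algebra.QuotRing"
    "HOL-Computational_Algebra.Polynomial"
    "Jordan_Normal_Form.Missing_VectorSpace"
begin

text \<open>
  A number field is a type of class \<^class>\<open>field_char_0\<close>, so that it contains a canonical copy of
  the rationals. ``Imaginary'' for a quadratic field means that it has no embedding into the reals.
\<close>

definition imaginary_quadratic_field :: "'k::field_char_0 itself \<Rightarrow> bool" where
  "imaginary_quadratic_field _ \<longleftrightarrow>
     vector_space.dim (\<lambda>(q::rat) (x::'k). of_rat q * x) UNIV = 2 \<and>
     (\<nexists>h :: 'k \<Rightarrow> real. h 1 = 1 \<and>
        (\<forall>x y. h (x + y) = h x + h y \<and> h (x * y) = h x * h y))"

definition ring_of_integers :: "'k::field_char_0 ring" where
  "ring_of_integers =
     \<lparr>carrier = {x. algebraic_int x}, monoid.mult = (*), one = 1, zero = 0, add = (+)\<rparr>"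

definition ideal_norm :: "'k::field_char_0 set \<Rightarrow> nat" where
  "ideal_norm A = card (carrier (ring_of_integers Quot A))"

text \<open>
  The ideal class of a nonzero ideal is its coset modulo the principal fractional ideals,
  hence a set of fractional ideals, not all of them integral.
\<close>

definition ideal_class :: "'k::field_char_0 set \<Rightarrow> 'k set set" where
  "ideal_class A = {(*) x ` A |x. x \<noteq> 0}"

definition modules_isomorphic ::
    "('a, 'm) ring_scheme \<Rightarrow> ('a, 'b, 'n) module_scheme \<Rightarrow> ('a, 'c, 'o) module_scheme \<Rightarrow> bool" where
  "modules_isomorphic R M N \<longleftrightarrow> (\<exists>f \<in> module_hom R M N. bij_betw f (carrier M) (carrier N))"

definition free_of_finite_rank :: "('a, 'm) ring_scheme \<Rightarrow> ('a, 'b, 'n) module_scheme \<Rightarrow> bool" where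
  "free_of_finite_rank R M \<longleftrightarrow>
     (\<exists>B \<subseteq> carrier M. finite B \<and> module.lin_indpt R M B \<and> module.gen_set R M B)"

text \<open>
  The rank of a finitely generated module over a domain: the maximal size of a linearly
  independent set, i.e. the dimension after extending scalars to the fraction field.
\<close>

definition module_rank :: "('a, 'm) ring_scheme \<Rightarrow> ('a, 'b, 'n) module_scheme \<Rightarrow> nat" where
  "module_rank R M =
     (GREATEST n. \<exists>S \<subseteq> carrier M. finite S \<and> card S = n \<and> module.lin_indpt R M S)"

definition torsion_submodule ::
    "('a, 'm) ring_scheme \<Rightarrow> ('a, 'b, 'n) module_scheme \<Rightarrow> ('a, 'b, 'n) module_scheme" where
  "torsion_submodule R M =
     M\<lparr>carrier := {x \<in> carrier M. \<exists>r \<in> carrier R. r \<noteq> \<zero>\<^bsub>R\<^esub> \<and> r \<odot>\<^bsub>M\<^esub> x = \<zero>\<^bsub>M\<^esub>}\<rparr>"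

definition ideal_module :: "('a, 'm) ring_scheme \<Rightarrow> 'a set \<Rightarrow> ('a, 'a) module" where
  "ideal_module R I =
     \<lparr>carrier = I, monoid.mult = monoid.mult R, one = \<one>\<^bsub>R\<^esub>, zero = \<zero>\<^bsub>R\<^esub>, add = add R,
      smult = monoid.mult R\<rparr>"

text \<open>
  The ideals \<open>A\<close> in decompositions \<open>M \<cong> M_tor \<oplus> O^(s-1) \<oplus> A\<close>, where \<open>s\<close> is the rank of \<open>M\<close>;
  the free summand consists of the functions from \<open>{..<s-1}\<close> to the ring of integers.
\<close>

definition steinitz_ideal :: "('k::field_char_0, 'b, 'n) module_scheme \<Rightarrow> 'k set \<Rightarrow> bool" where
  "steinitz_ideal M A \<longleftrightarrow>
     ideal A ring_of_integers \<and> A \<noteq> {0} \<and>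
     modules_isomorphic ring_of_integers M
       (direct_sum (torsion_submodule ring_of_integers M)
         (direct_sum (ring.func_space ring_of_integers {..<module_rank ring_of_integers M - 1})
           (ideal_module ring_of_integers A)))"

definition steinitz_class :: "('k::field_char_0, 'b, 'n) module_scheme \<Rightarrow> 'k set set" where
  "steinitz_class M =
     (if module_rank ring_of_integers M = 0 then ideal_class (carrier ring_of_integers)
      else THE C. \<exists>A. steinitz_ideal M A \<and> C = ideal_class A)"

end

theory Submission
  imports Defs "HOL-Algebra.Ideal_Product" "HOL-Library.Function_Algebras"
    "Jordan_Normal_Form.Determinant"
begin

text \<open>
  The proof is by induction on the rank. Projecting a finite index submodule of \<open>O^(n+1)\<close> to its
  last coordinate gives an ideal \<open>I\<close> of finite index, which is projective; so the module is
  \<open>M' \<oplus> I\<close> with \<open>M'\<close> of finite index in \<open>O^n\<close>, hence isomorphic to \<open>O^(n-1) \<oplus> A \<oplus> I\<close>, and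
  \<open>A \<oplus> I \<cong> O \<oplus> AI\<close>. Indices multiply along the way because \<open>O/I \<cong> A/AI\<close>.

  All facts about ideals follow from one property of a nonzero ideal \<open>I\<close> and an integer \<open>m \<noteq> 0\<close>:
  there are \<open>r \<in> I\<close> and \<open>q \<in> I^(-1)\<close> such that \<open>r q\<close> is an integer coprime to \<open>m\<close>. For \<open>I = \<int>a + \<int>b\<close>
  this holds since the binary quadratic form \<open>N(xa + yb) / N(I)\<close> is primitive.

  The class of \<open>A\<close> is an invariant of \<open>O^k \<oplus> A\<close>: an isomorphism onto \<open>O^k \<oplus> B\<close> is given by a matrix
  over \<open>K\<close>, and its determinant maps \<open>A\<close> onto \<open>B\<close>.
\<close>

section \<open>Transversals\<close>

text \<open>The property of ideals stands in for invertibility and for unique factorisation. If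
  \<open>m\<close> lies in \<open>I\<close>, Bezout's identity \<open>f' * f + m' * m = 1\<close>
  together with \<open>r * q = f\<close> writes 1 as an element of \<open>I I^(-1)\<close>, which
  gives the section onto \<open>I\<close>. If \<open>m\<close> lies in another ideal, the same
  identity compares two ideals: with \<open>r\<close> in \<open>A\<close> and \<open>m\<close> in
  \<open>B\<close> it makes \<open>r\<close> a generator of \<open>A\<close> modulo
  \<open>AB\<close>, and with the two ideals exchanged it gives a matrix of determinant 1 from
  \<open>A \<oplus> B\<close> to \<open>O \<oplus> AB\<close>. This is why \<open>m\<close> is left
  arbitrary.

  Indices are carried as sets of representatives, because the quotients of \<open>L\<close>, of
  \<open>O^(n+1)\<close> and of \<open>O\<close> consist of cosets in different types, while
  representatives can be added, scaled, projected to a coordinate and counted directly.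

  That sums and products of algebraic integers are integral is taken from the assumption that
  \<open>L\<close> is a module over \<open>ring_of_integers\<close>, which includes
  \<open>cring\<close>.\<close>

definition additive_subset :: "'a::ab_group_add set \<Rightarrow> bool" where
  "additive_subset H \<longleftrightarrow> 0 \<in> H \<and> (\<forall>x\<in>H. \<forall>y\<in>H. x - y \<in> H)"

definition transversal :: "'a::ab_group_add set \<Rightarrow> 'a set \<Rightarrow> 'a set \<Rightarrow> bool" where
  "transversal G H T \<longleftrightarrow> T \<subseteq> G \<and> (\<forall>g\<in>G. \<exists>!t. t \<in> T \<and> g - t \<in> H)"

lemma additive_subset_zero: "additive_subset H \<Longrightarrow> 0 \<in> H"
  and additive_subset_diff: "additive_subset H \<Longrightarrow> x \<in> H \<Longrightarrow> y \<in> H \<Longrightarrow> x - y \<in> H"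
  by (auto simp: additive_subset_def)

lemma additive_subset_minus: "additive_subset H \<Longrightarrow> x \<in> H \<Longrightarrow> - x \<in> H"
  using additive_subset_diff[of H 0 x] additive_subset_zero[of H] by simp

lemma additive_subset_add: "additive_subset H \<Longrightarrow> x \<in> H \<Longrightarrow> y \<in> H \<Longrightarrow> x + y \<in> H"
  using additive_subset_diff[of H x "-y"] additive_subset_minus[of H y] by simp

lemma additive_subset_diff_commute: "additive_subset H \<Longrightarrow> x - y \<in> H \<Longrightarrow> y - x \<in> H"
  using additive_subset_minus[of H "x - y"] by simp

lemma additive_subset_diff_trans:
  "additive_subset H \<Longrightarrow> x - y \<in> H \<Longrightarrow> y - z \<in> H \<Longrightarrow> x - z \<in> H"
  using additive_subset_add[of H "x - y" "y - z"] by simp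

lemma transversal_subset: "transversal G H T \<Longrightarrow> t \<in> T \<Longrightarrow> t \<in> G"
  by (auto simp: transversal_def)

lemma transversalE:
  assumes "transversal G H T" "g \<in> G"
  obtains t where "t \<in> T" "g - t \<in> H"
  using assms by (auto simp: transversal_def)

lemma transversal_unique:
  assumes "transversal G H T" "additive_subset H" "s \<in> T" "t \<in> T" "s - t \<in> H"
  shows "s = t"
proof -
  have "s \<in> G" "s - s \<in> H"
    using assms by (auto simp: transversal_def additive_subset_def)
  then show ?thesis
    using assms unfolding transversal_def by blast
qed

lemma transversalI:
  assumes "additive_subset H" "T \<subseteq> G" "\<And>g. g \<in> G \<Longrightarrow> \<exists>t\<in>T. g - t \<in> H"
    and "\<And>s t. s \<in> T \<Longrightarrow> t \<in> T \<Longrightarrow> s - t \<in> H \<Longrightarrow> s = t"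
  shows "transversal G H T"
  unfolding transversal_def
proof (intro conjI ballI)
  fix g assume g: "g \<in> G"
  then obtain t where t: "t \<in> T" "g - t \<in> H" using assms(3) by blast
  show "\<exists>!t. t \<in> T \<and> g - t \<in> H"
  proof (rule ex1I[of _ t])
    fix s assume "s \<in> T \<and> g - s \<in> H"
    then show "s = t"
      using t assms additive_subset_diff_trans[of H s g t] additive_subset_diff_commute[of H g s] by blast
  qed (use t in simp)
qed (use assms in simp)

lemma transversal_exists:
  assumes H: "additive_subset H"
  obtains T where "transversal G H T"
proof -
  define r where "r g = (SOME h. h \<in> G \<and> g - h \<in> H)" for g
  have r: "r g \<in> G" "g - r g \<in> H" if "g \<in> G" for g
  proof -
    have "g \<in> G \<and> g - g \<in> H" using that additive_subset_zero[OF H] by simp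
    then show "r g \<in> G" "g - r g \<in> H"
      unfolding r_def by (metis (mono_tags, lifting) someI_ex)+
  qed
  \<comment> \<open>For \<open>g\<close> and \<open>h\<close> in the same coset the predicates under
    \<open>SOME\<close> coincide, so the same representative is chosen for both.\<close>
  have req: "r g = r h" if "g - h \<in> H" for g h
  proof -
    have "(g - z \<in> H) = (h - z \<in> H)" for z
      using that additive_subset_diff_trans[OF H] additive_subset_diff_commute[OF H] by blast
    then show ?thesis by (simp add: r_def)
  qed
  have "transversal G H (r ` G)"
  proof (rule transversalI[OF H])
    fix s t assume "s \<in> r ` G" "t \<in> r ` G" "s - t \<in> H"
    then obtain g h where gh: "g \<in> G" "h \<in> G" "s = r g" "t = r h" by auto
    have "g - s \<in> H" "h - t \<in> H" using r gh by auto
    then have "g - h \<in> H"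
      using \<open>s - t \<in> H\<close> additive_subset_diff_trans[OF H] additive_subset_diff_commute[OF H] by blast
    then show "s = t" using req gh by simp
  qed (use r in auto)
  then show ?thesis using that by blast
qed

text \<open>Makes the index independent of the representatives: a given transversal can be compared
  with one built from a tower.\<close>

lemma transversal_bij_betw:
  assumes H: "additive_subset H" and T: "transversal G H T" and U: "transversal G H U"
  obtains f where "bij_betw f T U"
proof -
  have ex: "\<exists>u. u \<in> U \<and> t - u \<in> H" if "t \<in> T" for t
    using transversal_subset[OF T that] U by (metis transversalE)
  then obtain f where f: "\<And>t. t \<in> T \<Longrightarrow> f t \<in> U \<and> t - f t \<in> H" by metis
  have "bij_betw f T U"
    unfolding bij_betw_def
  proof (intro conjI inj_onI equalityI subsetI)
    fix s t assume st: "s \<in> T" "t \<in> T" "f s = f t"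
    then have "s - f t \<in> H" "f t - t \<in> H"
      using f[of s] f[of t] additive_subset_diff_commute[OF H] by auto
    then show "s = t"
      using transversal_unique[OF T H] st additive_subset_diff_trans[OF H] by blast
  next
    fix u assume u: "u \<in> U"
    then obtain t where t: "t \<in> T" "u - t \<in> H"
      using transversal_subset[OF U] T by (metis transversalE)
    then have "u - f t \<in> H" using f additive_subset_diff_trans[OF H] by blast
    then have "u = f t" using transversal_unique[OF U H u] f t by blast
    then show "u \<in> f ` T" using t by blast
  qed (use f in auto)
  then show ?thesis using that by blast
qed

text \<open>The index formula \<open>(G:H) = (G:N) (N:H)\<close>. Injectivity is stated separately
  so that the cardinalities multiply.\<close>

lemma transversal_tower:
  assumes H: "additive_subset H" and N: "additive_subset N" and "H \<subseteq> N" "N \<subseteq> G"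
    and G: "additive_subset G"
    and T: "transversal G N T" and U: "transversal N H U"
  shows "transversal G H ((\<lambda>(t, u). t + u) ` (T \<times> U))"
    and "inj_on (\<lambda>(t, u). t + u) (T \<times> U)"
proof -
  have key: "t = t' \<and> u = u'"
    if "t \<in> T" "t' \<in> T" "u \<in> U" "u' \<in> U" "(t + u) - (t' + u') \<in> H" for t t' u u'
  proof -
    have "u \<in> N" "u' \<in> N" using U that by (auto simp: transversal_def)
    then have "(t + u) - (t' + u') - (u - u') \<in> N"
      using that \<open>H \<subseteq> N\<close> additive_subset_diff[OF N] by blast
    then have "t - t' \<in> N" by (simp add: algebra_simps)
    then have "t = t'" using transversal_unique[OF T N] that by blast
    then show ?thesis using transversal_unique[OF U H, of u u'] that by simp
  qed
  then show "inj_on (\<lambda>(t, u). t + u) (T \<times> U)"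
    using additive_subset_zero[OF H] by (auto simp: inj_on_def)
  show "transversal G H ((\<lambda>(t, u). t + u) ` (T \<times> U))"
  proof (rule transversalI[OF H])
    show "(\<lambda>(t, u). t + u) ` (T \<times> U) \<subseteq> G"
      using T U \<open>N \<subseteq> G\<close> by (auto simp: transversal_def intro!: additive_subset_add[OF G])
  next
    fix g assume "g \<in> G"
    then obtain t where t: "t \<in> T" "g - t \<in> N" using T by (metis transversalE)
    then obtain u where u: "u \<in> U" "g - t - u \<in> H" using U by (metis transversalE)
    then have "g - (t + u) \<in> H" by (simp add: algebra_simps)
    then show "\<exists>x\<in>(\<lambda>(t, u). t + u) ` (T \<times> U). g - x \<in> H" using t u by blast
  qed (use key in auto)
qed

text \<open>The passage from representatives back to cosets. It is applied to the identity for
  \<open>O / A\<close>, to the coordinate map for \<open>L / M\<close>, and to a constant map when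
  \<open>L\<close> is zero.\<close>

lemma bij_betw_a_rcosets:
  fixes G :: "('b, 'm) ring_scheme" and \<psi> :: "'a::ab_group_add \<Rightarrow> 'b"
  assumes G: "abelian_group G" and H: "additive_subgroup H G"
    and bij: "bij_betw \<psi> G0 (carrier G)" and G0: "additive_subset G0"
    and add: "\<And>x y. x \<in> G0 \<Longrightarrow> y \<in> G0 \<Longrightarrow> \<psi> (x + y) = \<psi> x \<oplus>\<^bsub>G\<^esub> \<psi> y"
    and T: "transversal G0 {x \<in> G0. \<psi> x \<in> H} T"
  shows "bij_betw (\<lambda>t. H +>\<^bsub>G\<^esub> \<psi> t) T (a_rcosets\<^bsub>G\<^esub> H)"
proof -
  interpret G: abelian_group G by fact
  interpret H: additive_subgroup H G by fact
  interpret Hg: abelian_subgroup H G by (rule abelian_subgroupI3) fact+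
  let ?H0 = "{x \<in> G0. \<psi> x \<in> H}"
  have carr: "\<psi> x \<in> carrier G" if "x \<in> G0" for x using bij that by (auto simp: bij_betw_def)
  have diff: "\<psi> (x - y) = \<psi> x \<ominus>\<^bsub>G\<^esub> \<psi> y" if "x \<in> G0" "y \<in> G0" for x y
  proof -
    have "\<psi> (x - y) \<oplus>\<^bsub>G\<^esub> \<psi> y = \<psi> x"
      using add[of "x - y" y] that additive_subset_diff[OF G0] by simp
    then show ?thesis
      using carr[of "x - y"] carr that additive_subset_diff[OF G0]
      by (metis a_minus_def G.add.inv_solve_right')
  qed
  have H0: "additive_subset ?H0"
  proof -
    have "\<psi> 0 = \<zero>\<^bsub>G\<^esub>"
      using diff[of 0 0] additive_subset_zero[OF G0] carr[of 0] by (simp add: G.r_neg a_minus_def)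
    then show ?thesis
      using additive_subset_zero[OF G0] additive_subset_diff[OF G0] diff
      by (auto simp: additive_subset_def a_minus_def)
  qed
  have eq: "H +>\<^bsub>G\<^esub> \<psi> x = H +>\<^bsub>G\<^esub> \<psi> y \<longleftrightarrow> x - y \<in> ?H0" if "x \<in> G0" "y \<in> G0" for x y
  proof -
    have "H +>\<^bsub>G\<^esub> \<psi> x = H +>\<^bsub>G\<^esub> \<psi> y \<longleftrightarrow> \<psi> x \<in> H +>\<^bsub>G\<^esub> \<psi> y"
      using Hg.a_repr_independence' Hg.a_rcos_self carr that by metis
    also have "\<dots> \<longleftrightarrow> \<psi> x \<ominus>\<^bsub>G\<^esub> \<psi> y \<in> H"
      using Hg.a_rcos_module[OF carr carr, of y x] that by (simp add: a_minus_def)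
    finally show ?thesis using that additive_subset_diff[OF G0] diff by simp
  qed
  show ?thesis
    unfolding bij_betw_def
  proof (intro conjI inj_onI equalityI subsetI)
    fix s t assume "s \<in> T" "t \<in> T" "H +>\<^bsub>G\<^esub> \<psi> s = H +>\<^bsub>G\<^esub> \<psi> t"
    then show "s = t"
      using eq transversal_subset[OF T] transversal_unique[OF T H0] by blast
  next
    fix C assume "C \<in> (\<lambda>t. H +>\<^bsub>G\<^esub> \<psi> t) ` T"
    then show "C \<in> a_rcosets\<^bsub>G\<^esub> H"
      using transversal_subset[OF T] carr G.a_rcosetsI H.a_subset by auto
  next
    fix C assume "C \<in> a_rcosets\<^bsub>G\<^esub> H"
    then obtain g where "g \<in> carrier G" "C = H +>\<^bsub>G\<^esub> g"
      unfolding A_RCOSETS_def' by auto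
    moreover from this have "g \<in> \<psi> ` G0" using bij by (simp add: bij_betw_def)
    ultimately obtain x where x: "x \<in> G0" "C = H +>\<^bsub>G\<^esub> \<psi> x" by blast
    then obtain t where t: "t \<in> T" "x - t \<in> ?H0" using transversalE[OF T] by blast
    then have "H +>\<^bsub>G\<^esub> \<psi> x = H +>\<^bsub>G\<^esub> \<psi> t"
      using eq x(1) transversal_subset[OF T] by blast
    then show "C \<in> (\<lambda>t. H +>\<^bsub>G\<^esub> \<psi> t) ` T"
      using t(1) x(2) by blast
  qed
qed

section \<open>Arithmetic of quadratic fields\<close>

text \<open>Division with remainder by the least positive element; the zero group gives
  \<open>d = 0\<close>.\<close>

lemma int_subgroup_principal:
  fixes H :: "int set"
  assumes H: "additive_subset H"
  obtains d where "d \<in> H" "\<And>x. x \<in> H \<Longrightarrow> d dvd x"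
proof (cases "H \<subseteq> {0}")
  case True
  then show ?thesis using that[of 0] additive_subset_zero[OF H] by auto
next
  case False
  then obtain x where x: "x \<in> H" "x \<noteq> 0" by auto
  then have "\<bar>x\<bar> \<in> H" using additive_subset_minus[OF H] by (auto simp: abs_if)
  then have ex: "\<exists>n::nat. n > 0 \<and> int n \<in> H" using x by (intro exI[of _ "nat \<bar>x\<bar>"]) auto
  define n where "n = (LEAST n::nat. n > 0 \<and> int n \<in> H)"
  have n: "n > 0" "int n \<in> H" using LeastI_ex[OF ex] by (auto simp: n_def)
  have mult: "of_nat k * int n \<in> H" for k
    by (induction k) (use n additive_subset_zero[OF H] additive_subset_add[OF H] in \<open>auto simp: algebra_simps\<close>)
  have mult: "k * int n \<in> H" for k
    using mult[of "nat \<bar>k\<bar>"] additive_subset_minus[OF H, of "int (nat \<bar>k\<bar>) * int n"]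
    by (auto simp: abs_if split: if_splits)
  have "int n dvd x" if "x \<in> H" for x
  proof (rule ccontr)
    assume nd: "\<not> int n dvd x"
    have "x - (x div int n) * int n \<in> H" using additive_subset_diff[OF H that mult] .
    then have "x mod int n \<in> H" by (simp add: minus_div_mult_eq_mod)
    moreover have "x mod int n \<noteq> 0" using nd by (metis mod_eq_0_iff_dvd)
    moreover have "x mod int n \<ge> 0" "x mod int n < int n"
      using n pos_mod_sign pos_mod_bound by (metis of_nat_0_less_iff)+
    moreover define k where "k = nat (x mod int n)"
    ultimately have "k > 0 \<and> int k \<in> H" "k < n" by (auto simp del: mod_eq_0_iff_dvd)
    then show False using not_less_Least unfolding n_def by blast
  qed
  then show ?thesis using that n by blast
qed

text \<open>
  A prime divisor \<open>p\<close> of \<open>m\<close> divides the value \<open>x\<close> below iff \<open>p\<close> divides \<open>a\<close> but not \<open>c\<close>, and \<open>y\<close>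
  iff it does not divide \<open>a\<close>; so exactly one of the three terms survives modulo \<open>p\<close>.
\<close>

lemma primitive_form_represents_coprime:
  fixes a b c m :: int
  assumes prim: "\<And>d. d dvd a \<Longrightarrow> d dvd b \<Longrightarrow> d dvd c \<Longrightarrow> is_unit d" and m: "m \<noteq> 0"
  obtains x y where "coprime (a * x * x + b * x * y + c * y * y) m"
proof -
  let ?P = "prime_factors m"
  define x where "x = \<Prod>{p \<in> ?P. p dvd a \<and> \<not> p dvd c}"
  define y where "y = \<Prod>{p \<in> ?P. \<not> p dvd a}"
  have dvd_prod: "p dvd \<Prod>Q \<longleftrightarrow> p \<in> Q" if Q: "Q \<subseteq> ?P" "p \<in> ?P" for p Q
  proof
    assume "p \<in> Q"
    then show "p dvd \<Prod>Q" using Q finite_subset[OF Q(1)] by (intro dvd_prodI) auto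
  next
    have p: "prime p" using Q by auto
    assume "p dvd \<Prod>Q"
    then obtain q where "q \<in> Q" "p dvd q"
      using prime_dvd_prod_iff[OF finite_subset[OF Q(1)] p, of "\<lambda>q. q"] by auto
    moreover have "prime q" using \<open>q \<in> Q\<close> Q by auto
    ultimately show "p \<in> Q" using p primes_dvd_imp_eq by blast
  qed
  have "coprime (a * x * x + b * x * y + c * y * y) m"
  proof (rule ccontr)
    assume "\<not> coprime (a * x * x + b * x * y + c * y * y) m"
    then have "\<not> is_unit (gcd (a * x * x + b * x * y + c * y * y) m)"
      using is_unit_gcd by blast
    then obtain p where "prime p" "p dvd gcd (a * x * x + b * x * y + c * y * y) m"
      using prime_divisor_exists[of "gcd (a * x * x + b * x * y + c * y * y) m"] m by auto
    then have p: "prime p" "p dvd a * x * x + b * x * y + c * y * y" "p dvd m" by auto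
    then have pm: "p \<in> ?P" using m by (simp add: in_prime_factors_iff)
    have px: "p dvd x \<longleftrightarrow> p dvd a \<and> \<not> p dvd c" and py: "p dvd y \<longleftrightarrow> \<not> p dvd a"
      unfolding x_def y_def using dvd_prod[OF _ pm] pm by auto
    note pmul = prime_dvd_mult_iff[OF p(1)]
    have False if "\<not> p dvd a"
    proof -
      have "p dvd y" using that py by simp
      then have "p dvd b * x * y + c * y * y" by simp
      then have "p dvd a * x * x"
        using p(2) dvd_add_left_iff[of p "b * x * y + c * y * y" "a * x * x"] by (simp add: add.assoc)
      then show False using pmul px that by blast
    qed
    moreover have False if "p dvd a" "\<not> p dvd c"
    proof -
      have "p dvd x" using that px by simp
      then have "p dvd a * x * x + b * x * y" by simp
      then have "p dvd c * y * y"
        using p(2) dvd_add_right_iff[of p "a * x * x + b * x * y" "c * y * y"] by blast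
      then show False using pmul py that by blast
    qed
    \<comment> \<open>Here \<open>p\<close> divides neither \<open>x\<close> nor \<open>y\<close>,
      so the middle term forces \<open>p dvd b\<close>; this is the case where primitivity
      enters.\<close>
    moreover have False if "p dvd a" "p dvd c"
    proof -
      have "p dvd b * x * y"
        using that p(2) dvd_add_left_iff[of p "c * y * y" "a * x * x + b * x * y"]
          dvd_add_right_iff[of p "a * x * x" "b * x * y"] by simp
      then have "p dvd b" using pmul px py that by blast
      then show False using prim that p(1) not_prime_unit by blast
    qed
    ultimately show False by blast
  qed
  then show ?thesis using that by blast
qed

text \<open>What is kept of a quadratic field. Rational trace and norm make every element a root of
  a rational quadratic polynomial; \<delta> stands for a square root generating the field and makes
  the conjugation nontrivial.\<close>

locale quadratic_conjugation =
  fixes \<sigma> :: "'k::field_char_0 \<Rightarrow> 'k" and \<delta> :: 'k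
  assumes integers_cring: "cring (ring_of_integers :: 'k ring)"
    and conj_add: "\<sigma> (x + y) = \<sigma> x + \<sigma> y"
    and conj_mult: "\<sigma> (x * y) = \<sigma> x * \<sigma> y"
    and conj_one: "\<sigma> 1 = 1"
    and trace_rational: "x + \<sigma> x \<in> \<rat>"
    and norm_rational: "x * \<sigma> x \<in> \<rat>"
    and sqrt_nonzero: "\<delta> \<noteq> 0"
    and sqrt_integral: "algebraic_int \<delta>"
    and conj_sqrt: "\<sigma> \<delta> = - \<delta>"
begin

section \<open>Conjugation, trace, norm and integrality\<close>

lemma integral_add: "algebraic_int x \<Longrightarrow> algebraic_int y \<Longrightarrow> algebraic_int (x + y)"
  for x y :: 'k
proof -
  interpret cring "ring_of_integers :: 'k ring" by (rule integers_cring)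
  show "algebraic_int x \<Longrightarrow> algebraic_int y \<Longrightarrow> algebraic_int (x + y)"
    using a_closed[of x y] by (simp add: ring_of_integers_def)
qed

lemma integral_mult: "algebraic_int x \<Longrightarrow> algebraic_int y \<Longrightarrow> algebraic_int (x * y)"
  for x y :: 'k
proof -
  interpret cring "ring_of_integers :: 'k ring" by (rule integers_cring)
  show "algebraic_int x \<Longrightarrow> algebraic_int y \<Longrightarrow> algebraic_int (x * y)"
    using m_closed[of x y] by (simp add: ring_of_integers_def)
qed

lemma integral_diff: "algebraic_int x \<Longrightarrow> algebraic_int y \<Longrightarrow> algebraic_int (x - y)"
  for x y :: 'k
  using integral_add[of x "- y"] by simp

lemma conj_zero [simp]: "\<sigma> 0 = 0"
  using conj_add[of 0 0] by simp

lemma conj_minus: "\<sigma> (- x) = - \<sigma> x"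
  using conj_add[of x "- x"] by (simp add: eq_neg_iff_add_eq_0 add.commute)

lemma conj_diff: "\<sigma> (x - y) = \<sigma> x - \<sigma> y"
  using conj_add[of x "- y"] by (simp add: conj_minus)

lemma conj_of_nat: "\<sigma> (of_nat n) = of_nat n"
  by (induction n) (simp_all add: conj_add conj_one)

lemma conj_of_int [simp]: "\<sigma> (of_int n) = of_int n"
  by (cases n) (simp_all add: conj_of_nat conj_minus del: of_nat_Suc)

lemma conj_rational: "x \<in> \<rat> \<Longrightarrow> \<sigma> x = x"
proof -
  assume "x \<in> \<rat>"
  then obtain a b where ab: "b > 0" "x = of_int a / of_int b" by (auto elim: Rats_cases')
  then have "x * of_int b = of_int a" by simp
  then have "\<sigma> x * of_int b = x * of_int b" using conj_mult[of x "of_int b"] by auto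
  then show ?thesis using ab(1) by (metis mult_right_cancel of_int_eq_0_iff less_irrefl)
qed

text \<open>Involutivity is a consequence of the rational trace: \<open>x + \<sigma> x\<close> is
  fixed by \<sigma>.\<close>

lemma conj_conj: "\<sigma> (\<sigma> x) = x"
  using conj_rational[OF trace_rational[of x]] conj_add by (simp add: algebra_simps)

lemma conj_nonzero: "x \<noteq> 0 \<Longrightarrow> \<sigma> x \<noteq> 0"
  using conj_conj[of x] by auto

lemma conj_integral: "algebraic_int x \<Longrightarrow> algebraic_int (\<sigma> x)"
proof -
  assume "algebraic_int x"
  then obtain p :: "int poly" where p: "poly (map_poly of_int p) x = 0" "lead_coeff p = 1"
    by (auto simp: algebraic_int_altdef_ipoly)
  have "poly (map_poly of_int p) (\<sigma> x) = \<sigma> (poly (map_poly of_int p) x)"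
    by (induction p) (simp_all add: map_poly_pCons conj_add conj_mult)
  then show ?thesis using p by (auto simp: algebraic_int_altdef_ipoly)
qed

lemma integral_trace: "algebraic_int x \<Longrightarrow> x + \<sigma> x \<in> \<int>"
  and integral_norm: "algebraic_int x \<Longrightarrow> x * \<sigma> x \<in> \<int>"
  by (auto intro!: rational_algebraic_int_is_int integral_add integral_mult conj_integral
      trace_rational norm_rational)

text \<open>The element is a root of its characteristic polynomial
  \<open>X^2 - (x + \<sigma> x) X + x * \<sigma> x\<close>.\<close>

lemma integralI: "x + \<sigma> x \<in> \<int> \<Longrightarrow> x * \<sigma> x \<in> \<int> \<Longrightarrow> algebraic_int x"
proof -
  assume tn: "x + \<sigma> x \<in> \<int>" "x * \<sigma> x \<in> \<int>"
  let ?p = "[:x * \<sigma> x, - (x + \<sigma> x), 1:]"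
  have "\<forall>i. coeff ?p i \<in> \<int>"
    using tn by (auto simp: coeff_pCons simp del: minus_add_distrib split: nat.split)
  moreover have "poly ?p x = 0" by (simp add: algebra_simps)
  ultimately show ?thesis using algebraic_int.intros[of ?p x] by simp
qed

lemma integral_of_int_multiple:
  fixes x :: 'k
  obtains m :: int where "m \<noteq> 0" "algebraic_int (of_int m * x)"
proof -
  obtain a b where ab: "b > 0" "x + \<sigma> x = of_int a / of_int b"
    using trace_rational[of x] by (auto elim: Rats_cases')
  obtain c d where cd: "d > 0" "x * \<sigma> x = of_int c / of_int d"
    using norm_rational[of x] by (auto elim: Rats_cases')
  \<comment> \<open>The product of the denominators of trace and norm clears both: the trace scales
    by \<open>b * d\<close>, the norm by its square.\<close>
  have "algebraic_int (of_int (b * d) * x)"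
  proof (rule integralI)
    have "of_int (b * d) * x + \<sigma> (of_int (b * d) * x) = of_int (b * d) * (x + \<sigma> x)"
      unfolding conj_mult conj_of_int by (simp add: algebra_simps)
    also have "\<dots> = of_int (a * d)" using ab by simp
    finally show "of_int (b * d) * x + \<sigma> (of_int (b * d) * x) \<in> \<int>" by (metis Ints_of_int)
    have "of_int (b * d) * x * \<sigma> (of_int (b * d) * x) = of_int (b * d * (b * d)) * (x * \<sigma> x)"
      unfolding conj_mult conj_of_int by (simp add: algebra_simps)
    also have "\<dots> = of_int (b * b * d * c)" using cd by simp
    finally show "of_int (b * d) * x * \<sigma> (of_int (b * d) * x) \<in> \<int>" by (metis Ints_of_int)
  qed
  then show ?thesis using that[of "b * d"] ab cd by auto
qed

text \<open>Turns ideals into plain subsets of the field. Closure under negatives is absent on the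
  right because -1 is an integral scalar.\<close>

lemma ideal_iff:
  "ideal I (ring_of_integers :: 'k ring) \<longleftrightarrow>
     (\<forall>x\<in>I. algebraic_int x) \<and> 0 \<in> I \<and> (\<forall>x\<in>I. \<forall>y\<in>I. x + y \<in> I) \<and>
     (\<forall>x\<in>I. \<forall>c. algebraic_int c \<longrightarrow> c * x \<in> I)"
proof
  interpret O: cring "ring_of_integers :: 'k ring" by (rule integers_cring)
  {
    assume "ideal I (ring_of_integers :: 'k ring)"
    then interpret I: ideal I "ring_of_integers :: 'k ring" .
    show "(\<forall>x\<in>I. algebraic_int x) \<and> 0 \<in> I \<and> (\<forall>x\<in>I. \<forall>y\<in>I. x + y \<in> I) \<and>
     (\<forall>x\<in>I. \<forall>c. algebraic_int c \<longrightarrow> c * x \<in> I)"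
      using I.a_subset I.zero_closed I.a_closed I.I_l_closed
      by (auto simp: ring_of_integers_def)
  }
  {
    assume I: "(\<forall>x\<in>I. algebraic_int x) \<and> 0 \<in> I \<and> (\<forall>x\<in>I. \<forall>y\<in>I. x + y \<in> I) \<and>
     (\<forall>x\<in>I. \<forall>c. algebraic_int c \<longrightarrow> c * x \<in> I)"
    have "- x \<in> I" if "x \<in> I" for x
      using I that by (metis algebraic_int_1 algebraic_int_minus mult_minus1)
    moreover have "inv\<^bsub>add_monoid ring_of_integers\<^esub> x = - x" if "x \<in> I" for x
    proof -
      have "- x \<in> carrier (ring_of_integers :: 'k ring)" "x \<in> carrier (ring_of_integers :: 'k ring)"
        using I that by (auto simp: ring_of_integers_def)
      moreover have "x \<oplus>\<^bsub>ring_of_integers\<^esub> - x = \<zero>\<^bsub>ring_of_integers\<^esub>"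
        by (simp add: ring_of_integers_def)
      ultimately show ?thesis
        using O.minus_equality[of "- x" x] by (simp add: O.a_comm a_inv_def)
    qed
    ultimately show "ideal I (ring_of_integers :: 'k ring)"
      using I
      by (intro idealI O.ring_axioms) (auto simp: ring_of_integers_def subgroup_def mult.commute)
  }
qed

section \<open>Generators and inverses of ideals\<close>

lemma ideal_integral: "ideal I (ring_of_integers :: 'k ring) \<Longrightarrow> x \<in> I \<Longrightarrow> algebraic_int x"
  and ideal_zero: "ideal I (ring_of_integers :: 'k ring) \<Longrightarrow> 0 \<in> I"
  and ideal_add: "ideal I (ring_of_integers :: 'k ring) \<Longrightarrow> x \<in> I \<Longrightarrow> y \<in> I \<Longrightarrow> x + y \<in> I"
  and ideal_mult: "ideal I (ring_of_integers :: 'k ring) \<Longrightarrow> x \<in> I \<Longrightarrow> algebraic_int c \<Longrightarrow> c * x \<in> I"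
  by (simp_all add: ideal_iff)

lemma ideal_additive: "ideal I (ring_of_integers :: 'k ring) \<Longrightarrow> additive_subset I"
  using ideal_add[of I _ "- _"] ideal_mult[of I _ "-1"] ideal_zero
  unfolding additive_subset_def by (metis algebraic_int_1 algebraic_int_minus mult_minus1 uminus_add_conv_diff add.commute)

text \<open>The ideal is an extension of one subgroup of the integers by another: the image of
  \<tau>, and the kernel of \<tau>, which consists of the rational integers in \<open>I\<close>.
  Both are cyclic.\<close>

lemma ideal_two_generators:
  assumes I: "ideal I (ring_of_integers :: 'k ring)"
  obtains a b where "a \<in> I" "b \<in> I" "\<And>x. x \<in> I \<Longrightarrow> \<exists>s t :: int. x = of_int s * a + of_int t * b"
proof -
  note add = ideal_additive[OF I]
  \<comment> \<open>Since \<open>\<sigma> \<delta> = - \<delta>\<close>, this is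
    \<open>(x - \<sigma> x) * \<delta>\<close>: an integer on \<open>I\<close>, and zero exactly on
    the elements fixed by \<sigma>.\<close>
  define \<tau> where "\<tau> x = x * \<delta> + \<sigma> (x * \<delta>)" for x
  have \<tau>_diff: "\<tau> (x - y) = \<tau> x - \<tau> y" for x y
    by (simp add: \<tau>_def conj_mult conj_diff algebra_simps)
  have \<tau>_int: "\<tau> x \<in> \<int>" if "x \<in> I" for x
    unfolding \<tau>_def using I that by (intro integral_trace integral_mult sqrt_integral) (rule ideal_integral)
  define H where "H = {n::int. \<exists>x\<in>I. \<tau> x = of_int n}"
  define Z where "Z = {n::int. of_int n \<in> I}"
  have "additive_subset H"
    unfolding additive_subset_def
  proof (intro conjI ballI)
    show "0 \<in> H"
      using additive_subset_zero[OF add] by (auto simp: H_def \<tau>_def intro!: bexI[of _ 0])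
    fix m n assume "m \<in> H" "n \<in> H"
    then obtain x y where "x \<in> I" "\<tau> x = of_int m" "y \<in> I" "\<tau> y = of_int n"
      by (auto simp: H_def)
    then have "x - y \<in> I" "\<tau> (x - y) = of_int (m - n)"
      using additive_subset_diff[OF add] by (simp_all add: \<tau>_diff)
    then show "m - n \<in> H" unfolding H_def by blast
  qed
  then obtain d where d: "d \<in> H" "\<And>x. x \<in> H \<Longrightarrow> d dvd x" using int_subgroup_principal by blast
  then obtain b where b: "b \<in> I" "\<tau> b = of_int d" by (auto simp: H_def)
  have "additive_subset Z"
    unfolding additive_subset_def Z_def
    using additive_subset_zero[OF add] additive_subset_diff[OF add] by auto
  then obtain n where n: "n \<in> Z" "\<And>x. x \<in> Z \<Longrightarrow> n dvd x" using int_subgroup_principal by blast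
  have "\<exists>s t :: int. x = of_int s * of_int n + of_int t * b" if x: "x \<in> I" for x
  proof -
    obtain k where k: "\<tau> x = of_int k" using \<tau>_int[OF x] by (auto elim: Ints_cases)
    then have "k \<in> H" using x by (auto simp: H_def)
    then obtain t where t: "k = d * t" using d by auto
    define z where "z = x - of_int t * b"
    have zI: "z \<in> I" unfolding z_def
      using x b I by (intro additive_subset_diff[OF add] ideal_mult) auto
    have "\<tau> (of_int t * b) = of_int t * \<tau> b" by (simp add: \<tau>_def conj_mult algebra_simps)
    then have "\<tau> z = 0" unfolding z_def \<tau>_diff using k t b by simp
    then have "\<sigma> z = z" using sqrt_nonzero by (simp add: \<tau>_def conj_mult conj_sqrt)
    then have "z + z \<in> \<rat>" using trace_rational[of z] by simp
    then have "(z + z) / 2 \<in> \<rat>" by (intro Rats_divide) auto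
    then have "z \<in> \<int>" using ideal_integral[OF I zI] rational_algebraic_int_is_int by simp
    then obtain j where j: "z = of_int j" by (auto elim: Ints_cases)
    then have "j \<in> Z" using zI by (simp add: Z_def)
    then obtain s where "j = n * s" using n by auto
    then have "x = of_int s * of_int n + of_int t * b"
      using j by (simp add: z_def algebra_simps)
    then show ?thesis by blast
  qed
  then show ?thesis using that[of "of_int n" b] n b by (auto simp: Z_def)
qed

text \<open>
  If \<open>I = \<int>a + \<int>b\<close>, then the form \<open>N(xa + yb)\<close> divided by its content \<open>g\<close> is primitive, and
  \<open>\<sigma>(r) / g\<close> multiplies \<open>I\<close> into the ring of integers for every \<open>r\<close> in \<open>I\<close>.
\<close>

lemma ideal_element_coprime_norm:
  fixes m :: int
  assumes I: "ideal I (ring_of_integers :: 'k ring)" "I \<noteq> {0}" and m: "m \<noteq> 0"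
  obtains r q f where "r \<in> I" "\<And>x. x \<in> I \<Longrightarrow> algebraic_int (q * x)"
    "r * q = of_int f" "coprime f m"
proof -
  obtain a b where a: "a \<in> I" and b: "b \<in> I"
    and gen: "\<And>x. x \<in> I \<Longrightarrow> \<exists>s t :: int. x = of_int s * a + of_int t * b"
    using ideal_two_generators[OF I(1)] by blast
  have ai: "algebraic_int a" "algebraic_int b" using a b ideal_integral[OF I(1)] by auto
  obtain A where A: "a * \<sigma> a = of_int A" using integral_norm ai by (auto elim: Ints_cases)
  obtain C where C: "b * \<sigma> b = of_int C" using integral_norm ai by (auto elim: Ints_cases)
  obtain B where B: "a * \<sigma> b + \<sigma> a * b = of_int B"
  proof -
    have "a * \<sigma> b + \<sigma> (a * \<sigma> b) \<in> \<int>" using ai by (intro integral_trace integral_mult conj_integral)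
    then show ?thesis using that by (auto elim: Ints_cases simp: conj_mult conj_conj)
  qed
  have "a \<noteq> 0 \<or> b \<noteq> 0" using gen I ideal_zero[OF I(1)] by fastforce
  then have "A \<noteq> 0 \<or> C \<noteq> 0" using A C conj_nonzero by (metis mult_eq_0_iff of_int_0)
  define g where "g = gcd A (gcd B C)"
  have g: "g \<noteq> 0" using \<open>A \<noteq> 0 \<or> C \<noteq> 0\<close> by (auto simp: g_def)
  obtain A' B' C' where ABC: "A = g * A'" "B = g * B'" "C = g * C'"
    unfolding g_def by (meson dvdE gcd_dvd1 gcd_dvd2 dvd_trans)
  \<comment> \<open>A common divisor \<open>d\<close> of the quotients would make
    \<open>g * d\<close> a common divisor of \<open>A\<close>, \<open>B\<close>, \<open>C\<close>,
    hence a divisor of their gcd \<open>g\<close>.\<close>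
  have "is_unit d" if "d dvd A'" "d dvd B'" "d dvd C'" for d
  proof -
    have "g * d dvd g" unfolding g_def[symmetric]
      using that ABC by (subst (2) g_def) (intro gcd_greatest; simp add: mult_dvd_mono)
    then show ?thesis using g by simp
  qed
  then obtain x y where xy: "coprime (A' * x * x + B' * x * y + C' * y * y) m"
    using primitive_form_represents_coprime[OF _ m] by metis
  define r where "r = of_int x * a + of_int y * b"
  define q where "q = \<sigma> r / of_int g"
  have gk: "of_int g \<noteq> (0 :: 'k)" using g by simp
  have sr: "\<sigma> r = of_int x * \<sigma> a + of_int y * \<sigma> b" by (simp add: r_def conj_add conj_mult)
  have "r * \<sigma> r = of_int x * of_int x * (a * \<sigma> a) + of_int x * of_int y * (a * \<sigma> b + \<sigma> a * b)
      + of_int y * of_int y * (b * \<sigma> b)"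
    unfolding sr unfolding r_def by (simp add: algebra_simps)
  then have "r * q = of_int (A' * x * x + B' * x * y + C' * y * y)"
    unfolding q_def A B C ABC using gk by (simp add: field_simps)
  moreover have "r \<in> I" unfolding r_def using a b I by (intro ideal_add ideal_mult) auto
  moreover have "algebraic_int (q * z)" if z: "z \<in> I" for z
  proof -
    \<comment> \<open>The cross terms of \<open>q * z\<close> are integer multiples of
      \<open>u\<close> and \<open>\<sigma> u\<close>. Divisibility by \<open>g\<close> is known only
      for the sum \<open>a * \<sigma> b + \<sigma> a * b\<close>, but that sum and the norm suffice:
      \<open>u\<close> has trace \<open>B'\<close> and norm \<open>A' * C'\<close>.\<close>
    define u where "u = a * \<sigma> b / of_int g"
    have su: "\<sigma> u = \<sigma> a * b / of_int g"
    proof -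
      have "\<sigma> u * of_int g = \<sigma> a * b"
        using gk conj_mult[of u "of_int g"] by (simp add: u_def conj_mult conj_conj)
      then show ?thesis using gk by (simp add: field_simps)
    qed
    have "u + \<sigma> u = (a * \<sigma> b + \<sigma> a * b) / of_int g" unfolding su by (simp add: u_def add_divide_distrib)
    also have "\<dots> = of_int B'" using gk by (simp add: B ABC)
    finally have tr: "u + \<sigma> u \<in> \<int>" by simp
    have "u * \<sigma> u = (a * \<sigma> a) * (b * \<sigma> b) / (of_int g * of_int g)" unfolding su by (simp add: u_def)
    also have "\<dots> = of_int (A' * C')" using gk by (simp add: A C ABC)
    finally have ui: "algebraic_int u" using tr by (intro integralI) auto
    then have vi: "algebraic_int (\<sigma> u)" by (rule conj_integral)
    obtain s t :: int where "z = of_int s * a + of_int t * b" using gen[OF z] by blast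
    then have "q * z = of_int x * of_int s * (a * \<sigma> a / of_int g) + of_int x * of_int t * \<sigma> u
        + of_int y * of_int s * u + of_int y * of_int t * (b * \<sigma> b / of_int g)"
      unfolding q_def sr su unfolding u_def by (simp add: algebra_simps add_divide_distrib)
    also have "\<dots> = of_int (x * s * A') + of_int (x * t) * \<sigma> u + of_int (y * s) * u + of_int (y * t * C')"
      using gk by (simp add: A C ABC)
    finally show ?thesis
      using ui vi by (auto intro!: integral_add integral_mult)
  qed
  ultimately show ?thesis using that xy by blast
qed

text \<open>The norm of a nonzero element is its product with its integral conjugate, so it lies in
  the ideal.\<close>

lemma ideal_contains_int:
  assumes I: "ideal I (ring_of_integers :: 'k ring)" "I \<noteq> {0}"
  obtains m :: int where "m \<noteq> 0" "of_int m \<in> I"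
proof -
  obtain x where x: "x \<in> I" "x \<noteq> 0" using I ideal_zero by blast
  obtain m where m: "x * \<sigma> x = of_int m"
    using integral_norm ideal_integral[OF I(1) x(1)] by (auto elim: Ints_cases)
  have "of_int m \<in> I"
    unfolding m[symmetric] using ideal_mult[OF I(1) x(1), of "\<sigma> x"] conj_integral ideal_integral[OF I(1) x(1)]
    by (simp add: mult.commute)
  moreover have "m \<noteq> 0" using m x conj_nonzero by (metis mult_eq_0_iff of_int_0)
  ultimately show ?thesis using that by blast
qed

end

text \<open>Completing the square turns a basis \<open>{1, \<theta>}\<close> into
  \<open>{1, \<delta>}\<close> with an integer as square of \<delta>; conjugation flips the sign of
  the second coordinate.\<close>

lemma quadratic_conjugation_exists:
  assumes dim: "vector_space.dim (\<lambda>(q::rat) (x::'k::field_char_0). of_rat q * x) UNIV = 2"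
    and O: "cring (ring_of_integers :: 'k::field_char_0 ring)"
  obtains \<sigma> and \<delta> :: "'k::field_char_0" where "quadratic_conjugation \<sigma> \<delta>"
proof -
  interpret vs: vector_space "\<lambda>(q::rat) (x::'k). of_rat q * x"
    by unfold_locales (simp_all add: algebra_simps of_rat_add of_rat_mult)
  have ind1: "vs.independent {1}" by simp
  define E where "E = vs.extend_basis {1}"
  have E: "1 \<in> E" "vs.independent E" "vs.span E = UNIV"
    using vs.extend_basis_superset[OF ind1] vs.independent_extend_basis[OF ind1]
      vs.span_extend_basis[OF ind1] by (auto simp: E_def)
  have "card E = 2" using vs.basis_card_eq_dim[of E UNIV] E dim by simp
  then obtain \<theta> where \<theta>: "E = {1, \<theta>}" "\<theta> \<noteq> 1"
    using E(1) by (auto simp: card_2_iff)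
  have gen\<theta>: "\<exists>p q. x = of_rat p + of_rat q * \<theta>" for x
  proof -
    have "x \<in> vs.span (insert \<theta> {1})" using E(3) \<theta>(1) by (simp add: insert_commute)
    then obtain q where "x - of_rat q * \<theta> \<in> vs.span {1}" unfolding vs.span_breakdown_eq by blast
    then obtain p where "x - of_rat q * \<theta> = of_rat p" by (auto simp: vs.span_singleton)
    then show ?thesis by (metis diff_add_cancel)
  qed
  have irr\<theta>: "\<theta> \<noteq> of_rat p" for p
  proof -
    have "vs.independent (insert \<theta> {1})" using E(2) \<theta>(1) by (simp add: insert_commute)
    then have "\<theta> \<notin> vs.span {1}" using \<theta>(2) by (simp add: vs.independent_insert)
    then show ?thesis by (auto simp: vs.span_singleton)
  qed
  obtain \<alpha> \<beta> where sq\<theta>: "\<theta> * \<theta> = of_rat \<alpha> + of_rat \<beta> * \<theta>" using gen\<theta> by blast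
  \<comment> \<open>The number on the left is the square of \<open>\<theta> - \<beta> / 2\<close>.
    Scaling by its denominator \<open>w\<close> gives \<delta> the square
    \<open>w^2 * (u / w) = w * u\<close>, an integer, so that \<delta> is integral.\<close>
  obtain u w :: int where uw: "w > 0" "\<alpha> + \<beta> * \<beta> / 4 = of_int u / of_int w"
    by (metis quotient_of_denom_pos quotient_of_div surj_pair)
  define \<delta> where "\<delta> = of_int w * (\<theta> - of_rat (\<beta> / 2))"
  have w: "(of_int w :: 'k) \<noteq> 0" using uw by simp
  have sq: "\<delta> * \<delta> = of_int (w * u)"
  proof -
    have "\<delta> * \<delta> = of_int w * of_int w * (\<theta> * \<theta> - of_rat \<beta> * \<theta> + of_rat (\<beta> / 2) * of_rat (\<beta> / 2))"
      by (simp add: \<delta>_def of_rat_divide algebra_simps)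
    also have "\<theta> * \<theta> - of_rat \<beta> * \<theta> + of_rat (\<beta> / 2) * of_rat (\<beta> / 2) = of_rat (\<alpha> + \<beta> * \<beta> / 4)"
      unfolding sq\<theta> by (simp add: of_rat_add of_rat_mult of_rat_divide)
    also have "\<dots> = of_int u / of_int w" unfolding uw(2) by (simp add: of_rat_divide)
    finally show ?thesis using w by simp
  qed
  have gen: "\<exists>p q. x = of_rat p + of_rat q * \<delta>" for x
  proof -
    obtain p q where x: "x = of_rat p + of_rat q * \<theta>" using gen\<theta> by blast
    have "\<theta> = of_rat (\<beta> / 2) + of_rat (1 / of_int w) * \<delta>"
      using w by (simp add: \<delta>_def of_rat_divide)
    then have "x = of_rat (p + q * (\<beta> / 2)) + of_rat (q * (1 / of_int w)) * \<delta>"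
      unfolding x of_rat_add of_rat_mult by (simp add: algebra_simps)
    then show ?thesis by blast
  qed
  have irr: "\<delta> \<noteq> of_rat p" for p
  proof
    assume "\<delta> = of_rat p"
    then have "\<theta> - of_rat (\<beta> / 2) = of_rat p / of_int w"
      using w by (simp add: \<delta>_def nonzero_eq_divide_eq mult.commute)
    then have "\<theta> = of_rat (p / of_int w + \<beta> / 2)"
      by (simp add: of_rat_add of_rat_divide diff_eq_eq)
    then show False using irr\<theta> by blast
  qed
  have uniq: "p = p' \<and> q = q'" if eq: "of_rat p + of_rat q * \<delta> = of_rat p' + of_rat q' * \<delta>" for p q p' q'
  proof -
    have q: "q = q'"
    proof (rule ccontr)
      assume "q \<noteq> q'"
      then have "(of_rat (q - q') :: 'k) \<noteq> 0" by simp
      moreover have "of_rat (q - q') * \<delta> = of_rat (p' - p)"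
        using eq by (simp add: of_rat_diff algebra_simps)
      ultimately have "\<delta> = of_rat ((p' - p) / (q - q'))"
        by (simp add: of_rat_divide field_simps)
      then show False using irr by blast
    qed
    then show ?thesis using eq by simp
  qed
  \<comment> \<open>The coordinates are chosen, and \<open>uniq\<close> shows that any other
    expression of \<open>x\<close> has the same ones; hence \<sigma> can be evaluated on every
    expression.\<close>
  obtain P Q where PQ: "\<And>x. x = of_rat (P x) + of_rat (Q x) * \<delta>" using gen by metis
  define \<sigma> where "\<sigma> x = of_rat (P x) - of_rat (Q x) * \<delta>" for x
  have \<sigma>: "\<sigma> (of_rat p + of_rat q * \<delta>) = of_rat p - of_rat q * \<delta>" for p q
    using PQ[of "of_rat p + of_rat q * \<delta>"] uniq unfolding \<sigma>_def by metis
  define D where "D = (of_int (w * u) :: rat)"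
  have sqD: "\<delta> * \<delta> = of_rat D" unfolding sq D_def by (rule of_rat_of_int_eq[symmetric])
  have mult: "(of_rat p + of_rat q * \<delta>) * (of_rat p' + of_rat q' * \<delta>)
      = of_rat (p * p' + q * q' * D) + of_rat (p * q' + q * p') * \<delta>" for p q p' q'
  proof -
    have "(of_rat p + of_rat q * \<delta>) * (of_rat p' + of_rat q' * \<delta>)
      = of_rat p * of_rat p' + of_rat q * of_rat q' * (\<delta> * \<delta>) + (of_rat p * of_rat q' + of_rat q * of_rat p') * \<delta>"
      by (simp add: algebra_simps)
    then show ?thesis unfolding sqD by (simp add: of_rat_add of_rat_mult)
  qed
  have "quadratic_conjugation \<sigma> \<delta>"
  proof (rule quadratic_conjugation.intro)
    show "cring (ring_of_integers :: 'k ring)" by fact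
    show "\<sigma> (x + y) = \<sigma> x + \<sigma> y" for x y
    proof -
      have "x + y = of_rat (P x + P y) + of_rat (Q x + Q y) * \<delta>"
        by (subst (1) PQ[of x], subst (1) PQ[of y]) (simp add: of_rat_add algebra_simps)
      then show ?thesis by (simp only: \<sigma>) (simp add: \<sigma>_def of_rat_add algebra_simps)
    qed
    show "\<sigma> (x * y) = \<sigma> x * \<sigma> y" for x y
    proof -
      have "x * y = of_rat (P x * P y + Q x * Q y * D) + of_rat (P x * Q y + Q x * P y) * \<delta>"
        by (subst (1) PQ[of x], subst (1) PQ[of y]) (rule mult)
      moreover have "\<sigma> x * \<sigma> y = of_rat (P x * P y + Q x * Q y * D) - of_rat (P x * Q y + Q x * P y) * \<delta>"
      proof -
        have "\<sigma> x * \<sigma> y = of_rat (P x) * of_rat (P y) + of_rat (Q x) * of_rat (Q y) * (\<delta> * \<delta>)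
            - (of_rat (P x) * of_rat (Q y) + of_rat (Q x) * of_rat (P y)) * \<delta>"
          by (simp add: \<sigma>_def algebra_simps)
        then show ?thesis unfolding sqD by (simp add: of_rat_add of_rat_mult)
      qed
      ultimately show ?thesis by (simp only: \<sigma>)
    qed
    show "\<sigma> 1 = 1" using \<sigma>[of 1 0] by simp
    have tr: "x + \<sigma> x = of_rat (2 * P x)" and nm: "x * \<sigma> x = of_rat (P x * P x - Q x * Q x * D)" for x
    proof -
      have "x + \<sigma> x = (of_rat (P x) + of_rat (Q x) * \<delta>) + \<sigma> x" using PQ[of x] by simp
      then show "x + \<sigma> x = of_rat (2 * P x)" by (simp add: \<sigma>_def of_rat_mult)
      have "x * \<sigma> x = (of_rat (P x) + of_rat (Q x) * \<delta>) * \<sigma> x" using PQ[of x] by simp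
      also have "\<sigma> x = of_rat (P x) + of_rat (- Q x) * \<delta>" by (simp add: \<sigma>_def of_rat_minus)
      finally show "x * \<sigma> x = of_rat (P x * P x - Q x * Q x * D)" unfolding mult by (simp add: \<sigma>_def)
    qed
    show "x + \<sigma> x \<in> \<rat>" "x * \<sigma> x \<in> \<rat>" for x unfolding tr nm by simp_all
    show "\<delta> \<noteq> 0" using irr[of 0] by simp
    let ?p = "[:- of_int (w * u), 0, 1:] :: 'k poly"
    have "\<forall>i. coeff ?p i \<in> \<int>" by (auto simp: coeff_pCons simp del: of_int_mult split: nat.split)
    moreover have "poly ?p \<delta> = 0" by (simp add: sq)
    ultimately show "algebraic_int \<delta>" using algebraic_int.intros[of ?p \<delta>] by simp
    show "\<sigma> \<delta> = - \<delta>" using \<sigma>[of 0 1] by simp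
  qed
  then show ?thesis using that by blast
qed

section \<open>Products of ideals\<close>

context quadratic_conjugation
begin

lemma integers_additive: "additive_subset {x :: 'k. algebraic_int x}"
  by (simp add: additive_subset_def integral_diff)

lemma ideal_prod_memI:
  "x \<in> A \<Longrightarrow> y \<in> B \<Longrightarrow> x * y \<in> ideal_prod (ring_of_integers :: 'k ring) A B"
  using ideal_prod.prod[of x A y B "ring_of_integers :: 'k ring"] by (simp add: ring_of_integers_def)

lemma ideal_prod_ideal:
  assumes "ideal A (ring_of_integers :: 'k ring)" "ideal B (ring_of_integers :: 'k ring)"
  shows "ideal (ideal_prod ring_of_integers A B) (ring_of_integers :: 'k ring)"
proof -
  interpret cring "ring_of_integers :: 'k ring" by (rule integers_cring)
  show ?thesis using ideal_prod_is_ideal assms by blast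
qed

text \<open>The inclusion \<open>B^(-1) A B \<subseteq> A\<close>, checked on generators. The
  multiplier \<open>q = 1\<close> gives \<open>AB \<subseteq> A\<close>.\<close>

lemma ideal_prod_left:
  assumes A: "ideal A (ring_of_integers :: 'k ring)"
    and q: "\<And>b. b \<in> B \<Longrightarrow> algebraic_int (q * b)"
    and z: "z \<in> ideal_prod (ring_of_integers :: 'k ring) A B"
  shows "q * z \<in> A"
  using z
proof (induction z rule: ideal_prod.induct)
  case (prod i j)
  then have "(q * j) * i \<in> A" using A q by (intro ideal_mult)
  then show ?case by (simp add: ring_of_integers_def mult_ac)
next
  case (sum x y)
  then show ?case using ideal_add[OF A] by (simp add: ring_of_integers_def distrib_left)
qed

lemma ideal_prod_right:
  assumes B: "ideal B (ring_of_integers :: 'k ring)"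
    and p: "\<And>a. a \<in> A \<Longrightarrow> algebraic_int (p * a)"
    and z: "z \<in> ideal_prod (ring_of_integers :: 'k ring) A B"
  shows "p * z \<in> B"
  using z
proof (induction z rule: ideal_prod.induct)
  case (prod i j)
  then have "(p * i) * j \<in> B" using B p by (intro ideal_mult)
  then show ?case by (simp add: ring_of_integers_def mult_ac)
next
  case (sum x y)
  then show ?case using ideal_add[OF B] by (simp add: ring_of_integers_def distrib_left)
qed

lemma ideal_prod_nonzero:
  assumes "ideal A (ring_of_integers :: 'k ring)" "A \<noteq> {0}"
    and "ideal B (ring_of_integers :: 'k ring)" "B \<noteq> {0}"
  shows "ideal_prod (ring_of_integers :: 'k ring) A B \<noteq> {0}"
proof -
  obtain a b where "a \<in> A" "a \<noteq> 0" "b \<in> B" "b \<noteq> 0"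
    using assms ideal_zero by blast
  then show ?thesis using ideal_prod_memI[of a A b B] by (metis mult_eq_0_iff singletonD)
qed

text \<open>
  With \<open>r\<close> in \<open>A\<close> and \<open>r q\<close> coprime to an integer in \<open>B\<close>, multiplication by \<open>r\<close> induces an
  isomorphism from the integers modulo \<open>B\<close> onto \<open>A\<close> modulo \<open>AB\<close>.
\<close>

lemma ideal_prod_transversal:
  assumes A: "ideal A (ring_of_integers :: 'k ring)" "A \<noteq> {0}"
    and B: "ideal B (ring_of_integers :: 'k ring)" "B \<noteq> {0}"
    and U: "transversal {x. algebraic_int x} A U" and T: "transversal {x. algebraic_int x} B T"
  obtains V where "transversal {x. algebraic_int x} (ideal_prod (ring_of_integers :: 'k ring) A B) V"
    "card V = card U * card T"
proof -
  let ?P = "ideal_prod (ring_of_integers :: 'k ring) A B"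
  note Ba = ideal_additive[OF B(1)]
  have P: "ideal ?P (ring_of_integers :: 'k ring)" using ideal_prod_ideal A B by blast
  note Pa = ideal_additive[OF P]
  have PA: "?P \<subseteq> A" using ideal_prod_left[OF A(1), of B 1] ideal_integral[OF B(1)] by auto
  obtain m :: int where m: "m \<noteq> 0" "of_int m \<in> B" using ideal_contains_int[OF B] by blast
  obtain r q f where r: "r \<in> A" and q: "\<And>x. x \<in> A \<Longrightarrow> algebraic_int (q * x)"
    and rq: "r * q = of_int f" and f: "coprime f m"
    using ideal_element_coprime_norm[OF A m(1)] by blast
  obtain f' m' where bez: "f' * f + m' * m = 1"
    using f bezout_int[of f m] by (auto simp: coprime_iff_gcd_eq_1)
  \<comment> \<open>Injectivity: multiplying by \<open>q\<close> puts \<open>f * (s - t)\<close> in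
    \<open>B\<close>, and \<open>m * (s - t)\<close> is there because \<open>m\<close> is; Bezout
    puts \<open>s - t\<close> in \<open>B\<close>.\<close>
  have rT: "s = t" if "s \<in> T" "t \<in> T" "r * s - r * t \<in> ?P" for s t
  proof -
    have st: "algebraic_int (s - t)"
      using that T by (auto simp: transversal_def intro!: integral_diff)
    have "q * (r * s - r * t) \<in> B" using ideal_prod_right[OF B(1) q] that by blast
    also have "q * (r * s - r * t) = of_int f * (s - t)"
      unfolding rq[symmetric] by (simp add: algebra_simps)
    finally have "of_int f' * (of_int f * (s - t)) \<in> B"
      using ideal_mult[OF B(1), of _ "of_int f'"] by simp
    moreover have "of_int m' * ((s - t) * of_int m) \<in> B"
      using ideal_mult[OF B(1) ideal_mult[OF B(1) m(2) st], of "of_int m'"] by simp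
    ultimately have "of_int f' * (of_int f * (s - t)) + of_int m' * ((s - t) * of_int m) \<in> B"
      by (rule ideal_add[OF B(1)])
    also have "of_int f' * (of_int f * (s - t)) + of_int m' * ((s - t) * of_int m)
        = of_int (f' * f + m' * m) * (s - t)" by (simp add: algebra_simps)
    finally show "s = t" using transversal_unique[OF T Ba] that bez by simp
  qed
  have "transversal A ?P ((*) r ` T)"
  proof (rule transversalI[OF Pa])
    show "(*) r ` T \<subseteq> A"
      using T r ideal_mult[OF A(1)] by (auto simp: transversal_def mult.commute[of r])
  next
    fix y assume y: "y \<in> A"
    \<comment> \<open>Surjectivity: \<open>z\<close> is the preimage of \<open>y\<close> modulo
      \<open>B\<close>, for \<open>y - r * z = (1 - f' * f) * y = m' * m * y\<close> lies in
      \<open>AB\<close>.\<close>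
    define z where "z = of_int f' * (q * y)"
    have "algebraic_int z" unfolding z_def using integral_mult[OF _ q[OF y]] by simp
    then obtain t where t: "t \<in> T" "z - t \<in> B" using T by (metis mem_Collect_eq transversalE)
    have "y - r * z = y - of_int f' * (r * q) * y" by (simp add: z_def algebra_simps)
    also have "\<dots> = of_int (f' * f + m' * m) * y - of_int f' * of_int f * y"
      unfolding rq bez by simp
    also have "\<dots> = of_int m' * (y * of_int m)" by (simp add: algebra_simps)
    finally have "y - r * z \<in> ?P"
      using ideal_mult[OF P ideal_prod_memI[OF y m(2)], of "of_int m'"] by simp
    then have "(y - r * z) + r * (z - t) \<in> ?P"
      using ideal_prod_memI[OF r t(2)] additive_subset_add[OF Pa] by blast
    then have "y - r * t \<in> ?P" by (simp add: algebra_simps)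
    then show "\<exists>x\<in>(*) r ` T. y - x \<in> ?P" using t by blast
  qed (use rT in auto)
  note tower = transversal_tower[OF Pa ideal_additive[OF A(1)] PA _ integers_additive U this]
  have sub: "A \<subseteq> {x. algebraic_int x}" using ideal_integral[OF A(1)] by blast
  have "inj_on ((*) r) T" using rT additive_subset_zero[OF Pa] by (auto simp: inj_on_def)
  then have "card ((\<lambda>(t, u). t + u) ` (U \<times> (*) r ` T)) = card U * card T"
    using card_image[OF tower(2)[OF sub]] by (simp add: card_image card_cartesian_product)
  then show ?thesis using that tower(1)[OF sub] by blast
qed

text \<open>The matrix with rows \<open>(p, q)\<close> and \<open>(r, s)\<close> maps \<open>A \<oplus> B\<close> isomorphically onto \<open>O \<oplus> AB\<close>.\<close>

lemma ideal_pair_unimodular: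
  assumes A: "ideal A (ring_of_integers :: 'k ring)" "A \<noteq> {0}"
    and B: "ideal B (ring_of_integers :: 'k ring)" "B \<noteq> {0}"
  obtains p q r s where "\<And>a. a \<in> A \<Longrightarrow> algebraic_int (p * a)" "\<And>b. b \<in> B \<Longrightarrow> algebraic_int (q * b)"
    "r \<in> B" "s \<in> A" "p * s - q * r = 1"
proof -
  obtain m :: int where m: "m \<noteq> 0" "of_int m \<in> A" using ideal_contains_int[OF A] by blast
  obtain r q f where r: "r \<in> B" and q: "\<And>x. x \<in> B \<Longrightarrow> algebraic_int (q * x)"
    and rq: "r * q = of_int f" and f: "coprime f m"
    using ideal_element_coprime_norm[OF B m(1)] by blast
  obtain f' m' where bez: "f' * f + m' * m = 1"
    using f bezout_int[of f m] by (auto simp: coprime_iff_gcd_eq_1)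
  show ?thesis
  proof (rule that[of "of_int m'" "- of_int f' * q" r "of_int m"])
    show "algebraic_int (of_int m' * a)" if "a \<in> A" for a
      using ideal_integral[OF A(1) that] by (intro integral_mult) auto
    show "algebraic_int (- of_int f' * q * b)" if "b \<in> B" for b
      using integral_mult[OF _ q[OF that], of "- of_int f'"] by (simp add: mult.assoc)
    have "of_int m' * of_int m - (- of_int f' * q) * r = of_int (f' * f + m' * m)"
      using rq by (simp add: algebra_simps)
    then show "of_int m' * of_int m - (- of_int f' * q) * r = 1" unfolding bez by simp
  qed (use r m in auto)
qed

text \<open>Modulo the zero ideal every integer of the field would be its own representative, and
  there are infinitely many. This is how finite index excludes zero ideals in the induction.\<close>

lemma ideal_nonzero_if_finite_transversal:
  assumes U: "transversal {x. algebraic_int x} I U" and "finite U"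
  shows "I \<noteq> {0 :: 'k}"
proof
  assume I: "I = {0}"
  have "{x. algebraic_int x} \<subseteq> U"
  proof
    fix x :: 'k assume "x \<in> {x. algebraic_int x}"
    then obtain t where "t \<in> U" "x - t \<in> I" using U transversalE by blast
    then show "x \<in> U" using I by simp
  qed
  moreover have "range (of_nat :: nat \<Rightarrow> 'k) \<subseteq> {x. algebraic_int x}" by auto
  ultimately have "range (of_nat :: nat \<Rightarrow> 'k) \<subseteq> U" by (rule order_trans[rotated])
  then have "finite (range (of_nat :: nat \<Rightarrow> 'k))" using \<open>finite U\<close> by (rule finite_subset)
  moreover have "inj (of_nat :: nat \<Rightarrow> 'k)" by (simp add: inj_def)
  ultimately show False using range_inj_infinite by blast
qed

end

section \<open>Module isomorphisms\<close>

lemma modules_isomorphic_trans: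
  assumes "modules_isomorphic R M N" "modules_isomorphic R N P"
  shows "modules_isomorphic R M P"
proof -
  obtain f g where f: "f \<in> module_hom R M N" "bij_betw f (carrier M) (carrier N)"
    and g: "g \<in> module_hom R N P" "bij_betw g (carrier N) (carrier P)"
    using assms by (auto simp: modules_isomorphic_def)
  have "g \<circ> f \<in> module_hom R M P"
    using f(1) g(1) by (auto simp: module_hom_def Pi_iff)
  then show ?thesis
    using bij_betw_trans[OF f(2) g(2)] by (auto simp: modules_isomorphic_def)
qed

lemma modules_isomorphic_sym:
  assumes M: "module R M" and iso: "modules_isomorphic R M N"
  shows "modules_isomorphic R N M"
proof -
  interpret M: module R M by fact
  obtain f where f: "f \<in> module_hom R M N" "bij_betw f (carrier M) (carrier N)"
    using iso by (auto simp: modules_isomorphic_def)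
  define g where "g = inv_into (carrier M) f"
  have bij: "bij_betw g (carrier N) (carrier M)" using f(2) by (simp add: g_def bij_betw_inv_into)
  have gc: "g y \<in> carrier M" "f (g y) = y" if "y \<in> carrier N" for y
    using bij f(2) that by (auto simp: g_def bij_betw_def f_inv_into_f)
  have gf: "g (f x) = x" if "x \<in> carrier M" for x
    using f(2) that by (simp add: g_def bij_betw_inv_into_left)
  have "g \<in> module_hom R N M"
    unfolding module_hom_def mem_Collect_eq
  proof (intro conjI allI impI funcsetI)
    fix x y assume "x \<in> carrier N \<and> y \<in> carrier N"
    then show "g (x \<oplus>\<^bsub>N\<^esub> y) = g x \<oplus>\<^bsub>M\<^esub> g y"
      using gf[of "g x \<oplus>\<^bsub>M\<^esub> g y"] gc[of x] gc[of y] module_hom_add[OF f(1), of "g x" "g y"] by simp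
  next
    fix r x assume "r \<in> carrier R \<and> x \<in> carrier N"
    then show "g (r \<odot>\<^bsub>N\<^esub> x) = r \<odot>\<^bsub>M\<^esub> g x"
      using gf[of "r \<odot>\<^bsub>M\<^esub> g x"] gc[of x] module_hom_smult[OF f(1), of r "g x"] by simp
  qed (use gc in auto)
  then show ?thesis using bij by (auto simp: modules_isomorphic_def)
qed

section \<open>Lattices\<close>

text \<open>Vectors are functions on the natural numbers, so that \<open>K^n\<close> is contained in \<open>K^(n+1)\<close>.\<close>

definition coord_module :: "(nat \<Rightarrow> 'k::field_char_0) set \<Rightarrow> ('k, nat \<Rightarrow> 'k) module" where
  "coord_module S = \<lparr>carrier = S, monoid.mult = (\<lambda>x y. 0), one = 0, zero = 0, add = (+),
     smult = (\<lambda>c x i. c * x i)\<rparr>"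

definition integral_submodule :: "(nat \<Rightarrow> 'k::field_char_0) set \<Rightarrow> bool" where
  "integral_submodule S \<longleftrightarrow> 0 \<in> S \<and> (\<forall>x\<in>S. \<forall>y\<in>S. x + y \<in> S) \<and>
     (\<forall>x\<in>S. \<forall>c. algebraic_int c \<longrightarrow> (\<lambda>i. c * x i) \<in> S)"

text \<open>The module \<open>O^k \<oplus> A\<close> with \<open>A\<close> in coordinate
  \<open>k\<close>, hence of rank \<open>Suc k\<close>. With \<open>A\<close> the full ring it is
  the free module \<open>O^(k+1)\<close>; the zero module is not of this form.\<close>

definition std_lattice :: "nat \<Rightarrow> 'k::field_char_0 set \<Rightarrow> (nat \<Rightarrow> 'k) set" where
  "std_lattice k A = {x. (\<forall>i<k. algebraic_int (x i)) \<and> x k \<in> A \<and> (\<forall>i>k. x i = 0)}"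

lemma carrier_coord_module [simp]: "carrier (coord_module S) = S"
  and add_coord_module [simp]: "x \<oplus>\<^bsub>coord_module S\<^esub> y = x + y"
  and zero_coord_module [simp]: "\<zero>\<^bsub>coord_module S\<^esub> = 0"
  and smult_coord_module [simp]: "c \<odot>\<^bsub>coord_module S\<^esub> x = (\<lambda>i. c * x i)"
  by (simp_all add: coord_module_def)

lemma carrier_ring_of_integers [simp]: "carrier ring_of_integers = {x. algebraic_int x}"
  and mult_ring_of_integers [simp]: "x \<otimes>\<^bsub>ring_of_integers\<^esub> y = x * y"
  and add_ring_of_integers [simp]: "x \<oplus>\<^bsub>ring_of_integers\<^esub> y = x + y"
  and zero_ring_of_integers [simp]: "\<zero>\<^bsub>ring_of_integers\<^esub> = 0"
  and one_ring_of_integers [simp]: "\<one>\<^bsub>ring_of_integers\<^esub> = 1"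
  by (simp_all add: ring_of_integers_def)

lemma integral_submodule_zero: "integral_submodule S \<Longrightarrow> 0 \<in> S"
  and integral_submodule_add: "integral_submodule S \<Longrightarrow> x \<in> S \<Longrightarrow> y \<in> S \<Longrightarrow> x + y \<in> S"
  and integral_submodule_smult:
    "integral_submodule S \<Longrightarrow> x \<in> S \<Longrightarrow> algebraic_int c \<Longrightarrow> (\<lambda>i. c * x i) \<in> S"
  by (simp_all add: integral_submodule_def)

lemma integral_submodule_minus: "integral_submodule S \<Longrightarrow> x \<in> S \<Longrightarrow> - x \<in> S"
  using integral_submodule_smult[of S x "- 1"] by (simp add: fun_Compl_def)

lemma integral_submodule_diff: "integral_submodule S \<Longrightarrow> x \<in> S \<Longrightarrow> y \<in> S \<Longrightarrow> x - y \<in> S"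
  using integral_submodule_add[of S x "- y"] integral_submodule_minus[of S y] by simp

lemma integral_submodule_additive: "integral_submodule S \<Longrightarrow> additive_subset S"
  by (simp add: additive_subset_def integral_submodule_zero integral_submodule_diff)

text \<open>Bijectivity is shown by an explicit inverse; linearity is checked in the forward
  direction only.\<close>

lemma coord_module_isoI:
  assumes "\<And>x. x \<in> S \<Longrightarrow> f x \<in> T" "\<And>y. y \<in> T \<Longrightarrow> g y \<in> S"
    and "\<And>x. x \<in> S \<Longrightarrow> g (f x) = x" "\<And>y. y \<in> T \<Longrightarrow> f (g y) = y"
    and "\<And>x y. x \<in> S \<Longrightarrow> y \<in> S \<Longrightarrow> f (x + y) = f x + f y"
    and "\<And>c x. algebraic_int c \<Longrightarrow> x \<in> S \<Longrightarrow> f (\<lambda>i. c * x i) = (\<lambda>i. c * f x i)"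
  shows "modules_isomorphic ring_of_integers (coord_module S) (coord_module T)"
  unfolding modules_isomorphic_def
proof (intro bexI)
  show "bij_betw f (carrier (coord_module S)) (carrier (coord_module T))"
    using assms by (intro bij_betw_byWitness[where f' = g]) auto
  show "f \<in> module_hom ring_of_integers (coord_module S) (coord_module T)"
    using assms by (auto simp: module_hom_def)
qed

section \<open>Splitting lattices into a free part and one ideal\<close>

context quadratic_conjugation
begin

lemma coord_module_module:
  fixes S :: "(nat \<Rightarrow> 'k) set"
  assumes "integral_submodule S"
  shows "module ring_of_integers (coord_module S)"
proof (rule module_criteria)
  show "cring (ring_of_integers :: 'k ring)" by (rule integers_cring)
  show "\<forall>v\<in>carrier (coord_module S). \<exists>neg_v\<in>carrier (coord_module S).
      v \<oplus>\<^bsub>coord_module S\<^esub> neg_v = \<zero>\<^bsub>coord_module S\<^esub>"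
    using integral_submodule_minus[OF assms] by (auto intro!: bexI[of _ "- _"])
qed (use assms in \<open>auto simp: integral_submodule_def algebra_simps\<close>)

lemma ideal_integers: "ideal {x :: 'k. algebraic_int x} ring_of_integers"
  by (simp add: ideal_iff integral_add integral_mult)

lemma std_lattice_integral_submodule:
  assumes A: "ideal A (ring_of_integers :: 'k ring)"
  shows "integral_submodule (std_lattice k A)"
  using ideal_zero[OF A] ideal_add[OF A] ideal_mult[OF A]
  by (auto simp: integral_submodule_def std_lattice_def integral_add integral_mult)

text \<open>
  The coordinate maps \<open>S\<close> onto a projective ideal, so that a section \<open>c \<mapsto> c w\<close> exists.
\<close>

lemma last_coordinate_section:
  fixes S :: "(nat \<Rightarrow> 'k) set"
  assumes S: "integral_submodule S"
    and I: "ideal ((\<lambda>x. x n) ` S) ring_of_integers" "(\<lambda>x. x n) ` S \<noteq> {0}"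
  obtains w where "w n = 1" "\<And>c. c \<in> (\<lambda>x. x n) ` S \<Longrightarrow> (\<lambda>i. c * w i) \<in> S"
proof -
  let ?I = "(\<lambda>x. x n) ` S"
  obtain m :: int where m: "m \<noteq> 0" "of_int m \<in> ?I" using ideal_contains_int[OF I] by blast
  obtain r q f where r: "r \<in> ?I" and q: "\<And>x. x \<in> ?I \<Longrightarrow> algebraic_int (q * x)"
    and rq: "r * q = of_int f" and f: "coprime f m"
    using ideal_element_coprime_norm[OF I m(1)] by blast
  obtain f' m' where bez: "f' * f + m' * m = 1"
    using f bezout_int[of f m] by (auto simp: coprime_iff_gcd_eq_1)
  obtain x where x: "x \<in> S" "x n = of_int m" using m by auto
  obtain y where y: "y \<in> S" "y n = r" using r by auto
  define w where "w i = of_int m' * x i + of_int f' * q * y i" for i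
  have "w n = of_int (f' * f + m' * m)"
    using rq by (simp add: w_def x y algebra_simps)
  then have "w n = 1" unfolding bez by simp
  moreover have "(\<lambda>i. c * w i) \<in> S" if c: "c \<in> ?I" for c
  proof -
    have "(\<lambda>i. (c * of_int m') * x i) + (\<lambda>i. (of_int f' * (q * c)) * y i) \<in> S"
      using integral_mult[OF ideal_integral[OF I(1) c], of "of_int m'"]
        integral_mult[OF _ q[OF c], of "of_int f'"] x y
      by (intro integral_submodule_add[OF S] integral_submodule_smult[OF S]) auto
    also have "(\<lambda>i. (c * of_int m') * x i) + (\<lambda>i. (of_int f' * (q * c)) * y i) = (\<lambda>i. c * w i)"
      by (simp add: fun_eq_iff w_def algebra_simps)
    finally show ?thesis .
  qed
  ultimately show ?thesis using that by blast
qed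

text \<open>The section splits \<open>S\<close> into the kernel of the last coordinate and a copy of
  the ideal of last coordinates; the kernel is then replaced by its standard form.\<close>

lemma coord_module_split_last:
  fixes S :: "(nat \<Rightarrow> 'k) set"
  assumes S: "integral_submodule S" "S \<subseteq> std_lattice (Suc k) {x. algebraic_int x}"
    and I: "ideal ((\<lambda>x. x (Suc k)) ` S) ring_of_integers" "(\<lambda>x. x (Suc k)) ` S \<noteq> {0}"
    and A: "ideal A (ring_of_integers :: 'k ring)"
    and iso: "modules_isomorphic ring_of_integers (coord_module {x \<in> S. x (Suc k) = 0})
      (coord_module (std_lattice k A))"
  shows "modules_isomorphic ring_of_integers (coord_module S)
    (coord_module {x. (\<forall>i<k. algebraic_int (x i)) \<and> x k \<in> A \<and> x (Suc k) \<in> (\<lambda>x. x (Suc k)) ` S \<and>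
       (\<forall>i>Suc k. x i = 0)})"
    (is "modules_isomorphic _ _ (coord_module ?D)")
proof -
  let ?S' = "{x \<in> S. x (Suc k) = 0}" and ?I = "(\<lambda>x. x (Suc k)) ` S"
  obtain w where w: "w (Suc k) = 1" "\<And>c. c \<in> ?I \<Longrightarrow> (\<lambda>i. c * w i) \<in> S"
    using last_coordinate_section[OF S(1) I] by blast
  obtain \<phi> where \<phi>: "\<phi> \<in> module_hom ring_of_integers (coord_module ?S') (coord_module (std_lattice k A))"
    and bij: "bij_betw \<phi> ?S' (std_lattice k A)"
    using iso by (auto simp: modules_isomorphic_def)
  define \<psi> where "\<psi> = inv_into ?S' \<phi>"
  have \<psi>: "\<psi> y \<in> ?S'" "\<phi> (\<psi> y) = y" if "y \<in> std_lattice k A" for y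
    using bij that by (auto simp: \<psi>_def bij_betw_def f_inv_into_f intro: inv_into_into)
      (metis (mono_tags, lifting) inv_into_into mem_Collect_eq)+
  have \<psi>\<phi>: "\<psi> (\<phi> x) = x" if "x \<in> ?S'" for x
    using bij that by (simp add: \<psi>_def bij_betw_inv_into_left)
  have \<phi>c: "\<phi> x \<in> std_lattice k A" if "x \<in> ?S'" for x using bij that by (auto simp: bij_betw_def)
  have \<phi>0: "\<phi> x i = 0" if "x \<in> ?S'" "i > k" for x i using \<phi>c[OF that(1)] that by (auto simp: std_lattice_def)
  \<comment> \<open>The projection onto the kernel along \<open>w\<close>; its last coordinate
    vanishes because \<open>w (Suc k) = 1\<close>.\<close>
  define pr where "pr x = x - (\<lambda>i. x (Suc k) * w i)" for x
  have pr: "pr x \<in> ?S'" if "x \<in> S" for x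
    using that w by (auto simp: pr_def intro!: integral_submodule_diff[OF S(1)])
  have S0: "x i = 0" if "x \<in> S" "i > Suc k" for x i using S that by (auto simp: std_lattice_def)
  \<comment> \<open>The values of \<phi> vanish beyond coordinate \<open>k\<close>, so slot
    \<open>Suc k\<close> is free to store the last coordinate of \<open>x\<close>.\<close>
  define F where "F x i = (if i = Suc k then x (Suc k) else \<phi> (pr x) i)" for x i
  define y0 where "y0 y = (y :: nat \<Rightarrow> 'k)(Suc k := 0)" for y
  have y0: "y0 y \<in> std_lattice k A" if "y \<in> ?D" for y
    using that by (auto simp: y0_def std_lattice_def)
  define G where "G y = \<psi> (y0 y) + (\<lambda>i. y (Suc k) * w i)" for y
  show ?thesis
  proof (rule coord_module_isoI[where f = F and g = G])
    fix x assume x: "x \<in> S"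
    show "F x \<in> ?D"
      using \<phi>c[OF pr[OF x]] x by (auto simp: F_def std_lattice_def)
    have "y0 (F x) = \<phi> (pr x)"
      using \<phi>0[OF pr[OF x]] by (auto simp: y0_def F_def fun_eq_iff)
    then show "G (F x) = x"
      using \<psi>\<phi>[OF pr[OF x]] by (simp add: G_def) (simp add: pr_def F_def)
  next
    fix y assume y: "y \<in> ?D"
    show "G y \<in> S"
      using \<psi>(1)[OF y0[OF y]] w(2)[of "y (Suc k)"] y unfolding G_def
      by (intro integral_submodule_add[OF S(1)]) auto
    have G1: "G y (Suc k) = y (Suc k)" using \<psi>(1)[OF y0[OF y]] w by (simp add: G_def)
    then have "pr (G y) = \<psi> (y0 y)" unfolding pr_def by (simp add: G_def)
    then have "\<phi> (pr (G y)) = y0 y" using \<psi>(2)[OF y0[OF y]] by simp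
    then show "F (G y) = y" using G1 by (auto simp: F_def y0_def fun_eq_iff)
  next
    fix x y assume xy: "x \<in> S" "y \<in> S"
    have "pr (x + y) = pr x + pr y" by (simp add: pr_def fun_eq_iff algebra_simps)
    then have "\<phi> (pr (x + y)) = \<phi> (pr x) + \<phi> (pr y)"
      using module_hom_add[OF \<phi>, of "pr x" "pr y"] pr[OF xy(1)] pr[OF xy(2)] by simp
    then show "F (x + y) = F x + F y" by (simp add: F_def fun_eq_iff)
  next
    fix c :: 'k and x assume cx: "algebraic_int c" "x \<in> S"
    have "pr (\<lambda>i. c * x i) = (\<lambda>i. c * pr x i)" by (simp add: pr_def fun_eq_iff algebra_simps)
    then have "\<phi> (pr (\<lambda>i. c * x i)) = (\<lambda>i. c * \<phi> (pr x) i)"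
      using module_hom_smult[OF \<phi>, of c "pr x"] pr[OF cx(2)] cx by simp
    then show "F (\<lambda>i. c * x i) = (\<lambda>i. c * F x i)" by (simp add: F_def fun_eq_iff)
  qed
qed

text \<open>The unimodular matrix acts on the coordinates \<open>k\<close> and \<open>Suc k\<close>
  alone. Coordinate \<open>k\<close> becomes integral and joins the free part, and the product ideal
  lands in the last slot.\<close>

lemma coord_module_merge_ideals:
  assumes A: "ideal A (ring_of_integers :: 'k ring)" "A \<noteq> {0}"
    and B: "ideal B (ring_of_integers :: 'k ring)" "B \<noteq> {0}"
  shows "modules_isomorphic ring_of_integers
    (coord_module {x. (\<forall>i<k. algebraic_int (x i)) \<and> x k \<in> A \<and> x (Suc k) \<in> B \<and> (\<forall>i>Suc k. x i = 0)})
    (coord_module (std_lattice (Suc k) (ideal_prod ring_of_integers A B)))"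
    (is "modules_isomorphic _ (coord_module ?D) (coord_module ?E)")
proof -
  obtain p q r s where p: "\<And>a. a \<in> A \<Longrightarrow> algebraic_int (p * a)"
    and q: "\<And>b. b \<in> B \<Longrightarrow> algebraic_int (q * b)"
    and r: "r \<in> B" and s: "s \<in> A" and det: "p * s - q * r = 1"
    using ideal_pair_unimodular[OF A B] by blast
  let ?P = "ideal_prod (ring_of_integers :: 'k ring) A B"
  note P = ideal_prod_ideal[OF A(1) B(1)]
  define F where "F x = x(k := p * x k + q * x (Suc k), Suc k := r * x k + s * x (Suc k))" for x :: "nat \<Rightarrow> 'k"
  \<comment> \<open>The adjugate matrix, which is the inverse because the determinant is 1.\<close>
  define G where "G y = y(k := s * y k - q * y (Suc k), Suc k := p * y (Suc k) - r * y k)" for y :: "nat \<Rightarrow> 'k"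
  show ?thesis
  proof (rule coord_module_isoI[where f = F and g = G])
    fix x assume x: "x \<in> ?D"
    have "x k * r \<in> ?P" "s * x (Suc k) \<in> ?P" using x r s by (auto intro!: ideal_prod_memI)
    then have "r * x k + s * x (Suc k) \<in> ?P" using ideal_add[OF P] by (simp add: mult.commute)
    then show "F x \<in> ?E"
      using x p q by (auto simp: F_def std_lattice_def less_Suc_eq intro!: integral_add)
    have "s * (p * x k + q * x (Suc k)) - q * (r * x k + s * x (Suc k)) = (p * s - q * r) * x k"
      "p * (r * x k + s * x (Suc k)) - r * (p * x k + q * x (Suc k)) = (p * s - q * r) * x (Suc k)"
      by (simp_all add: algebra_simps)
    then show "G (F x) = x" unfolding det by (simp add: F_def G_def fun_eq_iff)
  next
    fix y assume y: "y \<in> ?E"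
    then have yk: "algebraic_int (y k)" and yP: "y (Suc k) \<in> ?P" by (auto simp: std_lattice_def)
    have "y k * s - q * y (Suc k) \<in> A"
      using additive_subset_diff[OF ideal_additive[OF A(1)]] ideal_mult[OF A(1) s yk]
        ideal_prod_left[OF A(1) q yP] by blast
    moreover have "p * y (Suc k) - y k * r \<in> B"
      using additive_subset_diff[OF ideal_additive[OF B(1)]] ideal_mult[OF B(1) r yk]
        ideal_prod_right[OF B(1) p yP] by blast
    ultimately show "G y \<in> ?D"
      using y by (auto simp: G_def std_lattice_def mult.commute)
    have "p * (s * y k - q * y (Suc k)) + q * (p * y (Suc k) - r * y k) = (p * s - q * r) * y k"
      "r * (s * y k - q * y (Suc k)) + s * (p * y (Suc k) - r * y k) = (p * s - q * r) * y (Suc k)"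
      by (simp_all add: algebra_simps)
    then show "F (G y) = y" unfolding det by (simp add: F_def G_def fun_eq_iff)
  qed (auto simp: F_def fun_eq_iff algebra_simps)
qed

lemma last_coordinate_ideal:
  fixes S :: "(nat \<Rightarrow> 'k) set"
  assumes S: "integral_submodule S" "S \<subseteq> std_lattice k {x. algebraic_int x}"
  shows "ideal ((\<lambda>x. x k) ` S) ring_of_integers"
  unfolding ideal_iff
proof (intro conjI ballI allI impI)
  fix a assume "a \<in> (\<lambda>x. x k) ` S"
  then show "algebraic_int a" using S(2) by (auto simp: std_lattice_def)
next
  show "0 \<in> (\<lambda>x. x k) ` S" using integral_submodule_zero[OF S(1)] by (auto intro!: image_eqI[of _ _ 0])
next
  fix a b assume "a \<in> (\<lambda>x. x k) ` S" "b \<in> (\<lambda>x. x k) ` S"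
  then obtain x y where "x \<in> S" "y \<in> S" "a = x k" "b = y k" by auto
  then show "a + b \<in> (\<lambda>x. x k) ` S"
    using integral_submodule_add[OF S(1), of x y] by (auto intro!: image_eqI[of _ _ "x + y"])
next
  fix a c :: 'k assume "a \<in> (\<lambda>x. x k) ` S" "algebraic_int c"
  then obtain x where "x \<in> S" "a = x k" by auto
  then show "c * a \<in> (\<lambda>x. x k) ` S"
    using integral_submodule_smult[OF S(1), of x c] \<open>algebraic_int c\<close>
    by (auto intro!: image_eqI[of _ _ "\<lambda>i. c * x i"])
qed

text \<open>The index is recorded as a transversal of \<open>A\<close>, to be read as the norm of
  \<open>A\<close> later. The ideal and the count have to be produced together, since both are
  multiplied by the contribution of the last coordinate.\<close>

lemma lattice_steinitz_form:
  fixes S :: "(nat \<Rightarrow> 'k) set"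
  assumes "integral_submodule S" "S \<subseteq> std_lattice k {x. algebraic_int x}"
    and "transversal (std_lattice k {x. algebraic_int x}) S T" "finite T"
  shows "\<exists>A U. ideal A (ring_of_integers :: 'k ring) \<and> A \<noteq> {0} \<and>
    modules_isomorphic ring_of_integers (coord_module S) (coord_module (std_lattice k A)) \<and>
    transversal {x. algebraic_int x} A U \<and> card U = card T"
  using assms
proof (induction k arbitrary: S T)
  case 0
  \<comment> \<open>With the single coordinate 0, the base case is rank one: \<open>S\<close> is a
    copy of an ideal.\<close>
  let ?I = "(\<lambda>x. x 0) ` S"
  have I: "ideal ?I (ring_of_integers :: 'k ring)" using last_coordinate_ideal 0 by blast
  have eq: "x = y" if "x \<in> std_lattice 0 {x :: 'k. algebraic_int x}" "y \<in> std_lattice 0 {x. algebraic_int x}" "x 0 = y 0" for x y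
    using that by (auto simp: std_lattice_def fun_eq_iff) (metis gr0I)
  have S: "S = std_lattice 0 ?I"
  proof (intro equalityI subsetI)
    fix x assume x: "x \<in> std_lattice 0 ?I"
    then obtain y where y: "y \<in> S" "x 0 = y 0" by (auto simp: std_lattice_def)
    moreover have "x \<in> std_lattice 0 {x. algebraic_int x}"
      using x ideal_integral[OF I] by (auto simp: std_lattice_def)
    ultimately show "x \<in> S" using eq[of x y] 0 by auto
  qed (use 0 in \<open>auto simp: std_lattice_def\<close>)
  note Sa = integral_submodule_additive[OF 0(1)]
  have mem: "x - y \<in> S" if "x \<in> std_lattice 0 {x. algebraic_int x}" "y \<in> std_lattice 0 {x. algebraic_int x}"
    "x 0 - y 0 \<in> ?I" for x y
    by (subst S) (use that in \<open>auto simp: std_lattice_def\<close>)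
  have U: "transversal {x. algebraic_int x} ?I ((\<lambda>x. x 0) ` T)"
  proof (rule transversalI[OF ideal_additive[OF I]])
    show "(\<lambda>x. x 0) ` T \<subseteq> {x. algebraic_int x}"
      using 0(3) by (auto simp: transversal_def std_lattice_def)
  next
    fix g :: 'k assume "g \<in> {x. algebraic_int x}"
    then have "(\<lambda>i. if i = 0 then g else 0) \<in> std_lattice 0 {x. algebraic_int x}"
      by (simp add: std_lattice_def)
    then obtain t where t: "t \<in> T" "(\<lambda>i. if i = 0 then g else 0) - t \<in> S"
      using transversalE[OF 0(3)] by blast
    then have "g - t 0 \<in> ?I" by (intro image_eqI[OF _ t(2)]) simp
    then show "\<exists>u\<in>(\<lambda>x. x 0) ` T. g - u \<in> ?I" using t by blast
  next
    fix u v assume "u \<in> (\<lambda>x. x 0) ` T" "v \<in> (\<lambda>x. x 0) ` T" "u - v \<in> ?I"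
    then obtain s t where "s \<in> T" "t \<in> T" "u = s 0" "v = t 0" "s 0 - t 0 \<in> ?I" by auto
    then show "u = v"
      using mem[of s t] transversal_unique[OF 0(3) Sa] transversal_subset[OF 0(3)] by blast
  qed
  have "inj_on (\<lambda>x. x 0) T"
    using eq transversal_subset[OF 0(3)] by (auto intro!: inj_onI)
  then have "card ((\<lambda>x. x 0) ` T) = card T" by (rule card_image)
  moreover have "?I \<noteq> {0}"
    using ideal_nonzero_if_finite_transversal[OF U] 0(4) by simp
  moreover have "modules_isomorphic ring_of_integers (coord_module S) (coord_module (std_lattice 0 ?I))"
    unfolding S[symmetric] by (rule coord_module_isoI[where f = "\<lambda>x. x" and g = "\<lambda>x. x"]) auto
  ultimately show ?case using I U by blast
next
  case (Suc k)
  let ?G = "std_lattice (Suc k) {x :: 'k. algebraic_int x}"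
  let ?I = "(\<lambda>x. x (Suc k)) ` S"
  let ?S' = "{x \<in> S. x (Suc k) = 0}"
  \<comment> \<open>The intermediate group in the tower: \<open>?G\<close> modulo \<open>?N\<close>
    is \<open>O\<close> modulo \<open>?I\<close>, and \<open>?N\<close> modulo \<open>S\<close> is
    \<open>O^(k+1)\<close> modulo \<open>?S'\<close>.\<close>
  let ?N = "{x \<in> ?G. x (Suc k) \<in> ?I}"
  define e where "e u = (\<lambda>i. if i = Suc k then u else 0)" for u :: 'k
  have I: "ideal ?I (ring_of_integers :: 'k ring)" using last_coordinate_ideal Suc.prems by blast
  note Sa = integral_submodule_additive[OF Suc.prems(1)] and Ia = ideal_additive[OF I]
  have Ga: "additive_subset ?G"
    using integral_submodule_additive std_lattice_integral_submodule ideal_integers by blast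
  have Na: "additive_subset ?N"
    using additive_subset_zero[OF Ga] additive_subset_diff[OF Ga]
      additive_subset_zero[OF Ia] additive_subset_diff[OF Ia]
    by (auto simp: additive_subset_def)
  have S': "integral_submodule ?S'"
    using Suc.prems(1) by (auto simp: integral_submodule_def)
  have kG: "std_lattice k {x :: 'k. algebraic_int x} = {x \<in> ?G. x (Suc k) = 0}"
  proof -
    have "(\<forall>i>k. x i = 0) \<longleftrightarrow> x (Suc k) = 0 \<and> (\<forall>i>Suc k. x i = 0)" for x :: "nat \<Rightarrow> 'k"
      by (metis Suc_lessD Suc_lessI lessI)
    then show ?thesis by (auto simp: std_lattice_def less_Suc_eq)
  qed
  have S'k: "?S' \<subseteq> std_lattice k {x. algebraic_int x}"
    using Suc.prems(2) unfolding kG by blast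
  obtain U where U: "transversal {x. algebraic_int x} ?I U"
    using transversal_exists[OF Ia] by blast
  obtain T' where T': "transversal (std_lattice k {x. algebraic_int x}) ?S' T'"
    using transversal_exists[OF integral_submodule_additive[OF S']] by blast
  have eU: "transversal ?G ?N (e ` U)"
  proof (rule transversalI[OF Na])
    show "e ` U \<subseteq> ?G" using transversal_subset[OF U] by (auto simp: e_def std_lattice_def)
  next
    fix g assume g: "g \<in> ?G"
    then have "g (Suc k) \<in> {x. algebraic_int x}" by (simp add: std_lattice_def)
    then obtain u where u: "u \<in> U" "g (Suc k) - u \<in> ?I" using transversalE[OF U] by blast
    have "e u \<in> ?G" using transversal_subset[OF U u(1)] by (auto simp: e_def std_lattice_def)
    then have "g - e u \<in> ?N" using u additive_subset_diff[OF Ga g] by (simp add: e_def)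
    then show "\<exists>t\<in>e ` U. g - t \<in> ?N" using u by blast
  next
    fix s t assume "s \<in> e ` U" "t \<in> e ` U" "s - t \<in> ?N"
    then obtain u v where uv: "u \<in> U" "v \<in> U" "s = e u" "t = e v" "u - v \<in> ?I"
      by (auto simp: e_def)
    then show "s = t" using transversal_unique[OF U Ia] by blast
  qed
  have T'N: "transversal ?N S T'"
  proof (rule transversalI[OF Sa])
    show "T' \<subseteq> ?N"
    proof
      fix t assume "t \<in> T'"
      then have "t \<in> ?G" "t (Suc k) = 0" using transversal_subset[OF T'] unfolding kG by auto
      then show "t \<in> ?N" using additive_subset_zero[OF Ia] by (metis (mono_tags, lifting) mem_Collect_eq)
    qed
  next
    fix g assume g: "g \<in> ?N"
    \<comment> \<open>Subtracting an element of \<open>S\<close> with the same last coordinate moves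
      \<open>g\<close> into the kernel without changing its coset.\<close>
    then obtain s where s: "s \<in> S" "g (Suc k) = s (Suc k)" by auto
    then have "g - s \<in> std_lattice k {x. algebraic_int x}"
      using g Suc.prems(2) additive_subset_diff[OF Ga, of g s] unfolding kG by auto
    then obtain t where t: "t \<in> T'" "g - s - t \<in> ?S'" using transversalE[OF T'] by blast
    then have "(g - s - t) + s \<in> S" using additive_subset_add[OF Sa] s by blast
    then have "g - t \<in> S" by (simp add: algebra_simps)
    then show "\<exists>t\<in>T'. g - t \<in> S" using t by blast
  next
    fix s t assume st: "s \<in> T'" "t \<in> T'" "s - t \<in> S"
    then have "s (Suc k) = 0" "t (Suc k) = 0" using transversal_subset[OF T'] unfolding kG by auto
    then have "s - t \<in> ?S'" using st by simp
    then show "s = t" using transversal_unique[OF T' integral_submodule_additive[OF S']] st by blast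
  qed
  let ?V = "(\<lambda>(t, u). t + u) ` (e ` U \<times> T')"
  have SN: "S \<subseteq> ?N" using Suc.prems(2) by auto
  have NG: "?N \<subseteq> ?G" by blast
  note V = transversal_tower[OF Sa Na SN NG Ga eU T'N]
  obtain h where h: "bij_betw h T ?V" using transversal_bij_betw[OF Sa Suc.prems(3) V(1)] by blast
  have "finite ?V" using h Suc.prems(4) bij_betw_finite by blast
  then have fin: "finite (e ` U \<times> T')" using finite_imageD[OF _ V(2)] by blast
  have einj: "inj_on e U" by (auto simp: inj_on_def e_def fun_eq_iff)
  have "card T = card ?V" using bij_betw_same_card[OF h] .
  also have "\<dots> = card U * card T'"
    using card_image[OF V(2)] card_image[OF einj] by (simp add: card_cartesian_product)
  finally have cT: "card T = card U * card T'" .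
  \<comment> \<open>Finiteness of the product yields finiteness of a factor once the other one is
    nonempty; here 0 has a representative in each transversal.\<close>
  have "(0::'k) \<in> {x. algebraic_int x}" by simp
  then have "U \<noteq> {}" using transversalE[OF U] by blast
  then have "finite T'" using finite_cartesian_productD2[OF fin] by blast
  have "0 \<in> std_lattice k {x :: 'k. algebraic_int x}" by (simp add: std_lattice_def)
  then have "T' \<noteq> {}" using transversalE[OF T'] by blast
  then have "finite U" using finite_cartesian_productD1[OF fin] finite_imageD[OF _ einj] by blast
  then have I0: "?I \<noteq> {0}" using ideal_nonzero_if_finite_transversal[OF U] by blast
  obtain A W where A: "ideal A (ring_of_integers :: 'k ring)" "A \<noteq> {0}"
    and iso: "modules_isomorphic ring_of_integers (coord_module ?S') (coord_module (std_lattice k A))"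
    and W: "transversal {x. algebraic_int x} A W" "card W = card T'"
    using Suc.IH[OF S' S'k T' \<open>finite T'\<close>] by blast
  obtain V' where V': "transversal {x. algebraic_int x} (ideal_prod ring_of_integers A ?I) V'"
    "card V' = card W * card U"
    using ideal_prod_transversal[OF A I I0 W(1) U] by blast
  have "modules_isomorphic ring_of_integers (coord_module S)
      (coord_module (std_lattice (Suc k) (ideal_prod ring_of_integers A ?I)))"
    using modules_isomorphic_trans[OF coord_module_split_last[OF Suc.prems(1,2) I I0 A(1) iso]
        coord_module_merge_ideals[OF A I I0]] .
  moreover have "card V' = card T" using V'(2) W(2) cT by simp
  ultimately show ?case
    using V'(1) ideal_prod_ideal[OF A(1) I] ideal_prod_nonzero[OF A I I0] by blast
qed

end

section \<open>Uniqueness of the Steinitz class\<close>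

lemma ideal_class_scale:
  assumes "d \<noteq> 0"
  shows "ideal_class ((*) d ` A) = ideal_class A"
proof -
  have *: "(*) x ` (*) d ` A = (*) (x * d) ` A" for x by (simp add: image_image mult.assoc)
  have "\<exists>y. (*) x ` (*) d ` A = (*) y ` A \<and> y \<noteq> 0" "\<exists>y. (*) x ` A = (*) y ` (*) d ` A \<and> y \<noteq> 0"
    if "x \<noteq> 0" for x
    unfolding * using that assms by (auto intro: exI[of _ "x * d"] exI[of _ "x / d"])
  then show ?thesis by (auto simp: ideal_class_def)
qed

definition coord_vec :: "'k::field_char_0 \<Rightarrow> nat \<Rightarrow> nat \<Rightarrow> 'k" where
  "coord_vec a j = (\<lambda>i. if i = j then a else 0)"

lemma coord_vec_std_lattice:
  assumes "0 \<in> A" "j < k \<Longrightarrow> algebraic_int a" "j = k \<Longrightarrow> a \<in> A" "j \<le> k"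
  shows "coord_vec a j \<in> std_lattice k A"
  using assms by (auto simp: coord_vec_def std_lattice_def)

text \<open>The matrix of the \<open>K\<close>-linear extension of \<open>f\<close>. The unit vector
  of index \<open>k\<close> need not lie in the lattice, as \<open>A\<close> may not contain 1; so
  all unit vectors are scaled by \<open>a\<close> in \<open>A\<close>, and the images divided by
  \<open>a\<close>.\<close>

definition hom_matrix ::
    "nat \<Rightarrow> 'k::field_char_0 \<Rightarrow> ((nat \<Rightarrow> 'k) \<Rightarrow> nat \<Rightarrow> 'k) \<Rightarrow> 'k mat" where
  "hom_matrix k a f = mat (Suc k) (Suc k) (\<lambda>(i, j). f (coord_vec a j) i / a)"

section \<open>The determinant of a lattice homomorphism\<close>

context quadratic_conjugation
begin

text \<open>The coordinates of \<open>x\<close> are themselves integral scalars, so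
  \<open>a * x\<close> is the sum of \<open>x j\<close> times \<open>coord_vec a j\<close>, a
  combination inside the lattice to which \<open>f\<close> applies.\<close>

lemma hom_matrix_apply:
  assumes f: "f \<in> module_hom ring_of_integers (coord_module (std_lattice k A)) (coord_module T)"
    and A: "ideal A (ring_of_integers :: 'k ring)" and a: "a \<in> A" "a \<noteq> 0"
    and x: "x \<in> std_lattice k A" and i: "i \<le> k"
  shows "f x i = (\<Sum>j<Suc k. hom_matrix k a f $$ (i, j) * x j)"
proof -
  let ?L = "std_lattice k A"
  note L = std_lattice_integral_submodule[OF A, of k]
  have fadd: "f (x + y) = f x + f y" if "x \<in> ?L" "y \<in> ?L" for x y
    using module_hom_add[OF f, of x y] that by simp
  have fsmult: "f (\<lambda>i. c * x i) = (\<lambda>i. c * f x i)" if "x \<in> ?L" "algebraic_int c" for c x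
    using module_hom_smult[OF f, of c x] that by simp
  have ai: "algebraic_int a" using ideal_integral[OF A a(1)] .
  have xi: "algebraic_int (x j)" if "j \<le> k" for j
    using x that ideal_integral[OF A] by (cases "j = k") (auto simp: std_lattice_def)
  have e: "coord_vec a j \<in> ?L" if "j \<le> k" for j
    using that ai a ideal_zero[OF A] by (intro coord_vec_std_lattice) auto
  have part: "(\<lambda>j. if j < n then a * x j else 0) \<in> ?L \<and>
      f (\<lambda>j. if j < n then a * x j else 0) = (\<lambda>i. \<Sum>j<n. x j * f (coord_vec a j) i)" if "n \<le> Suc k" for n
    using that
  proof (induction n)
    case 0
    \<comment> \<open>That \<open>f\<close> maps 0 to 0 is obtained from homogeneity with the scalar
      0.\<close>
    have "f (\<lambda>i. 0 * x i) = (\<lambda>i. 0 * f x i)" using fsmult[OF x, of 0] by simp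
    then show ?case using integral_submodule_zero[OF L] by (simp add: zero_fun_def)
  next
    case (Suc n)
    have split: "(\<lambda>j. if j < Suc n then a * x j else 0) =
        (\<lambda>j. if j < n then a * x j else 0) + (\<lambda>i. x n * coord_vec a n i)"
      by (auto simp: fun_eq_iff coord_vec_def less_Suc_eq)
    have n: "n \<le> k" using Suc.prems by simp
    have m: "(\<lambda>i. x n * coord_vec a n i) \<in> ?L"
      using integral_submodule_smult[OF L e[OF n] xi[OF n]] .
    show ?case
      unfolding split using Suc n integral_submodule_add[OF L _ m] fadd[OF _ m] fsmult[OF e[OF n] xi[OF n]]
      by (simp add: fun_eq_iff)
  qed
  have "(\<lambda>j. if j < Suc k then a * x j else 0) = (\<lambda>j. a * x j)"
    using x by (auto simp: std_lattice_def fun_eq_iff)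
  then have "a * f x i = (\<Sum>j<Suc k. x j * f (coord_vec a j) i)"
    using part[of "Suc k"] fsmult[OF x ai] by (simp add: fun_eq_iff)
  then have "f x i = (\<Sum>j<Suc k. x j * f (coord_vec a j) i) / a"
    using a by (simp add: field_simps)
  also have "\<dots> = (\<Sum>j<Suc k. hom_matrix k a f $$ (i, j) * x j)"
    unfolding sum_divide_distrib using i
    by (intro sum.cong) (auto simp: hom_matrix_def)
  finally show ?thesis .
qed

text \<open>Scaling the last column by \<open>z\<close> makes every column the image of a lattice
  vector. The last row then has entries in \<open>B\<close> and the other rows integral entries, and
  each Leibniz term contains exactly one entry of the last row.\<close>

lemma det_hom_matrix_mem:
  assumes f: "f \<in> module_hom ring_of_integers (coord_module (std_lattice k A)) (coord_module (std_lattice k B))"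
    and A: "ideal A (ring_of_integers :: 'k ring)" and B: "ideal B (ring_of_integers :: 'k ring)"
    and a: "a \<in> A" "a \<noteq> 0" and z: "z \<in> A"
  shows "det (hom_matrix k a f) * z \<in> B"
proof -
  let ?F = "hom_matrix k a f"
  define c where "c j = (if j = k then z else 1)" for j
  define H where "H = mat (Suc k) (Suc k) (\<lambda>(i, j). ?F $$ (i, j) * c j)"
  have F: "?F \<in> carrier_mat (Suc k) (Suc k)" by (simp add: hom_matrix_def)
  have H: "H \<in> carrier_mat (Suc k) (Suc k)" by (simp add: H_def)
  have Hf: "H $$ (i, j) = f (coord_vec (c j) j) i" and mem: "f (coord_vec (c j) j) \<in> std_lattice k B"
    if "i \<le> k" "j \<le> k" for i j
  proof -
    have cj: "coord_vec (c j) j \<in> std_lattice k A"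
      using that z ideal_zero[OF A] by (intro coord_vec_std_lattice) (auto simp: c_def)
    then show "f (coord_vec (c j) j) \<in> std_lattice k B"
      using module_hom_closed[OF f] by auto
    have "(\<Sum>l<Suc k. ?F $$ (i, l) * coord_vec (c j) j l) = (\<Sum>l\<in>{j}. ?F $$ (i, l) * coord_vec (c j) j l)"
      using that by (intro sum.mono_neutral_right) (auto simp: coord_vec_def)
    then show "H $$ (i, j) = f (coord_vec (c j) j) i"
      using hom_matrix_apply[OF f A a cj that(1)] that by (simp add: H_def coord_vec_def)
  qed
  have "det H = det ?F * z"
  proof -
    \<comment> \<open>The expansion indexed by columns is used here, since the scaling is by
      columns; the expansion indexed by rows serves for membership in \<open>B\<close>.\<close>
    have "(\<Prod>j<Suc k. H $$ (p j, j)) = (\<Prod>j<Suc k. ?F $$ (p j, j)) * z"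
      if "p permutes {0..<Suc k}" for p
    proof -
      have "p j < Suc k" if "j < Suc k" for j
        using permutes_in_image[OF \<open>p permutes {0..<Suc k}\<close>, of j] that by simp
      then have "(\<Prod>j<Suc k. H $$ (p j, j)) = (\<Prod>j<Suc k. ?F $$ (p j, j) * c j)"
        by (intro prod.cong) (auto simp: H_def)
      also have "\<dots> = (\<Prod>j<Suc k. ?F $$ (p j, j)) * (\<Prod>j<Suc k. c j)" by (rule prod.distrib)
      also have "(\<Prod>j<Suc k. c j) = z" by (simp add: c_def)
      finally show ?thesis .
    qed
    then show ?thesis
      unfolding det_col[OF F] det_col[OF H] sum_distrib_right
      by (intro sum.cong) (auto simp: mult.assoc)
  qed
  moreover have "det H \<in> B"
  proof -
    have summand: "signof p * (\<Prod>i = 0..<Suc k. H $$ (i, p i)) \<in> B" if p: "p permutes {0..<Suc k}" for p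
    proof -
      have pj: "p i \<le> k" if "i \<le> k" for i
        using permutes_in_image[OF p, of i] that by simp
      have Hi: "algebraic_int (H $$ (i, p i))" if "i < k" for i
        using mem[of i "p i"] Hf[of i "p i"] pj[of i] that by (simp add: std_lattice_def)
      have Hk: "H $$ (k, p k) \<in> B"
        using mem[of k "p k"] Hf[of k "p k"] pj[of k] by (simp add: std_lattice_def)
      have "algebraic_int (\<Prod>i = 0..<n. H $$ (i, p i))" if "n \<le> k" for n
        using that by (induction n) (auto intro!: integral_mult Hi)
      then have "algebraic_int (signof p * (\<Prod>i = 0..<k. H $$ (i, p i)))"
        by (intro integral_mult) auto
      then show ?thesis using ideal_mult[OF B Hk, of "signof p * (\<Prod>i = 0..<k. H $$ (i, p i))"] by (simp add: mult.assoc)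
    qed
    have "(\<Sum>p\<in>P. signof p * (\<Prod>i = 0..<Suc k. H $$ (i, p i))) \<in> B"
      if "finite P" "P \<subseteq> {p. p permutes {0..<Suc k}}" for P
      using that by (induction P rule: finite_induct) (auto intro!: ideal_add[OF B] summand ideal_zero[OF B]
          simp del: prod.op_ivl_Suc)
    from this[OF finite_permutations] show ?thesis unfolding det_def'[OF H] by simp
  qed
  ultimately show ?thesis by simp
qed

text \<open>The matrices of \<open>f\<close> and its inverse are inverse to each other. The
  determinant of the first maps \<open>A\<close> into \<open>B\<close>, that of the second maps
  \<open>B\<close> into \<open>A\<close>, and their product is 1, so both inclusions are
  equalities.\<close>

lemma std_lattice_iso_imp_ideal_class_eq:
  assumes A: "ideal A (ring_of_integers :: 'k ring)" "A \<noteq> {0}"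
    and B: "ideal B (ring_of_integers :: 'k ring)" "B \<noteq> {0}"
    and iso: "modules_isomorphic ring_of_integers (coord_module (std_lattice k A)) (coord_module (std_lattice k B))"
  shows "ideal_class A = ideal_class B"
proof -
  obtain f where f: "f \<in> module_hom ring_of_integers (coord_module (std_lattice k A)) (coord_module (std_lattice k B))"
    and bij: "bij_betw f (std_lattice k A) (std_lattice k B)"
    using iso by (auto simp: modules_isomorphic_def)
  define g where "g = inv_into (std_lattice k A) f"
  have fg: "f (g y) = y" if "y \<in> std_lattice k B" for y
    using bij_betw_inv_into_right[OF bij that] by (simp add: g_def)
  have gc: "g y \<in> std_lattice k A" if "y \<in> std_lattice k B" for y
    using bij_betw_apply[OF bij_betw_inv_into[OF bij] that] by (simp add: g_def)
  have gf: "g (f x) = x" if "x \<in> std_lattice k A" for x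
    using bij that by (simp add: g_def bij_betw_inv_into_left)
  note LA = std_lattice_integral_submodule[OF A(1), of k]
  have g: "g \<in> module_hom ring_of_integers (coord_module (std_lattice k B)) (coord_module (std_lattice k A))"
    unfolding module_hom_def
  proof (intro CollectI conjI allI impI funcsetI; simp)
    fix x y assume xy: "x \<in> std_lattice k B \<and> y \<in> std_lattice k B"
    then have "f (g x + g y) = x + y" using module_hom_add[OF f, of "g x" "g y"] gc fg by simp
    then show "g (x + y) = g x + g y" using gf[of "g x + g y"] integral_submodule_add[OF LA] gc xy by simp
  next
    fix c :: 'k and x assume cx: "algebraic_int c \<and> x \<in> std_lattice k B"
    then have "f (\<lambda>i. c * g x i) = (\<lambda>i. c * x i)" using module_hom_smult[OF f, of c "g x"] gc fg by simp
    then show "g (\<lambda>i. c * x i) = (\<lambda>i. c * g x i)"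
      using gf[of "\<lambda>i. c * g x i"] integral_submodule_smult[OF LA, of "g x" c] gc cx by simp
  qed (use gc in auto)
  obtain a b where a: "a \<in> A" "a \<noteq> 0" and b: "b \<in> B" "b \<noteq> 0"
    using A B ideal_zero by blast
  let ?F = "hom_matrix k a f" and ?G = "hom_matrix k b g"
  have cF: "?F \<in> carrier_mat (Suc k) (Suc k)" "?G \<in> carrier_mat (Suc k) (Suc k)"
    by (simp_all add: hom_matrix_def)
  have "?F * ?G = 1\<^sub>m (Suc k)"
  proof (rule eq_matI)
    fix i j assume ij: "i < dim_row (1\<^sub>m (Suc k) :: 'k mat)" "j < dim_col (1\<^sub>m (Suc k) :: 'k mat)"
    then have ij: "i \<le> k" "j \<le> k" by simp_all
    have e: "coord_vec b j \<in> std_lattice k B"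
      using ij b ideal_zero[OF B(1)] ideal_integral[OF B(1)] by (intro coord_vec_std_lattice) auto
    \<comment> \<open>Column \<open>j\<close> of the product is read off by applying
      \<open>f\<close> to \<open>g (coord_vec b j)\<close>, which returns
      \<open>coord_vec b j\<close>.\<close>
    have "coord_vec b j i = (\<Sum>l<Suc k. ?F $$ (i, l) * g (coord_vec b j) l)"
      using hom_matrix_apply[OF f A(1) a gc[OF e] ij(1)] fg[OF e] by simp
    also have "\<dots> = (\<Sum>l<Suc k. ?F $$ (i, l) * ?G $$ (l, j)) * b"
      unfolding sum_distrib_right using ij b by (intro sum.cong) (auto simp: hom_matrix_def)
    also have "(\<Sum>l<Suc k. ?F $$ (i, l) * ?G $$ (l, j)) = (?F * ?G) $$ (i, j)"
      using cF ij by (simp add: scalar_prod_def atLeast0LessThan del: sum.lessThan_Suc)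
    finally show "(?F * ?G) $$ (i, j) = 1\<^sub>m (Suc k) $$ (i, j)"
      using ij b by (auto simp: coord_vec_def split: if_splits)
  qed (use cF in auto)
  then have dd: "det ?F * det ?G = 1" using det_mult[OF cF] by simp
  have "B = (*) (det ?F) ` A"
  proof (intro equalityI subsetI)
    fix y assume "y \<in> B"
    then have "det ?G * y \<in> A" using det_hom_matrix_mem[OF g B(1) A(1) b] by blast
    moreover have "y = det ?F * (det ?G * y)" using dd by (simp add: mult.assoc[symmetric])
    ultimately show "y \<in> (*) (det ?F) ` A" by blast
  qed (use det_hom_matrix_mem[OF f A(1) B(1) a] in auto)
  moreover have "det ?F \<noteq> 0" using dd by auto
  ultimately show ?thesis using ideal_class_scale by metis
qed

end

section \<open>Ranks\<close>

lemma lin_indpt_image: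
  assumes M: "module R M" and N: "module R N" and f: "f \<in> module_hom R M N"
    and inj: "inj_on f (carrier M)" and S: "S \<subseteq> carrier M" "\<not> module.lin_dep R M S"
  shows "\<not> module.lin_dep R N (f ` S)"
proof
  interpret mod_hom R M N f
    using M N f by (simp add: mod_hom_def mod_hom_axioms_def)
  assume "N.lin_dep (f ` S)"
  then obtain A a v where A: "finite A" "A \<subseteq> f ` S" "a \<in> A \<rightarrow> carrier R"
    "N.lincomb a A = \<zero>\<^bsub>N\<^esub>" "v \<in> A" "a v \<noteq> \<zero>\<^bsub>R\<^esub>"
    unfolding N.lin_dep_def by blast
  obtain C where C: "C \<subseteq> S" "inj_on f C" "A = f ` C" using A(2) by (metis subset_image_inj)
  have CM: "C \<subseteq> carrier M" using C(1) S(1) by blast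
  have aC: "(\<lambda>x. a (f x)) \<in> C \<rightarrow> carrier R" using A(3) C(3) by auto
  have "f (M.lincomb (\<lambda>x. a (f x)) C) = (\<Oplus>\<^bsub>N\<^esub>x\<in>C. f (a (f x) \<odot>\<^bsub>M\<^esub> x))"
    unfolding M.lincomb_def using CM aC by (intro hom_sum) auto
  also have "\<dots> = (\<Oplus>\<^bsub>N\<^esub>x\<in>C. a (f x) \<odot>\<^bsub>N\<^esub> f x)"
  proof (rule N.M.finsum_cong')
    fix x assume "x \<in> C"
    then have "a (f x) \<in> carrier R" "x \<in> carrier M" using Pi_mem[OF aC] CM by auto
    then show "f (a (f x) \<odot>\<^bsub>M\<^esub> x) = a (f x) \<odot>\<^bsub>N\<^esub> f x"
      by (rule module_hom_smult[OF f])
  qed (use CM aC in auto)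
  also have "\<dots> = N.lincomb a A"
    unfolding N.lincomb_def C(3) using CM A(3) C by (intro N.M.finsum_reindex[symmetric]) auto
  finally have "f (M.lincomb (\<lambda>x. a (f x)) C) = f \<zero>\<^bsub>M\<^esub>" using A(4) by simp
  then have "M.lincomb (\<lambda>x. a (f x)) C = \<zero>\<^bsub>M\<^esub>"
    using inj_onD[OF inj _ M.lincomb_closed[OF CM aC] M.M.zero_closed] by blast
  moreover have "finite C" using A(1) C by (simp add: finite_image_iff)
  moreover obtain c where "c \<in> C" "v = f c" using A(5) C(3) by blast
  ultimately show False
    using S(2) M.lin_dep_crit[of C S "\<lambda>x. a (f x)" c] C(1) aC A(6) by blast
qed

text \<open>The predicates under \<open>GREATEST\<close> agree for both modules, so the ranks agree
  without any bound on the size of independent sets.\<close>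

lemma module_rank_iso:
  assumes M: "module R M" and N: "module R N" and iso: "modules_isomorphic R M N"
  shows "module_rank R M = module_rank R N"
proof -
  have transfer: "\<exists>T \<subseteq> carrier N. finite T \<and> card T = n \<and> \<not> module.lin_dep R N T"
    if M: "module R M" and N: "module R N" and iso: "modules_isomorphic R M N"
      and ex: "\<exists>S \<subseteq> carrier M. finite S \<and> card S = n \<and> \<not> module.lin_dep R M S"
    for n M N
  proof -
    obtain f where f: "f \<in> module_hom R M N" "bij_betw f (carrier M) (carrier N)"
      using iso by (auto simp: modules_isomorphic_def)
    obtain S where S: "S \<subseteq> carrier M" "finite S" "card S = n" "\<not> module.lin_dep R M S"
      using ex by blast
    have inj: "inj_on f (carrier M)" using f(2) by (simp add: bij_betw_def)
    have "card (f ` S) = n" using card_image[OF inj_on_subset[OF inj S(1)]] S(3) by simp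
    moreover have "f ` S \<subseteq> carrier N" using f(2) S(1) by (auto simp: bij_betw_def)
    ultimately show ?thesis
      using lin_indpt_image[OF M N f(1) inj S(1,4)] S(2) by blast
  qed
  have "(\<exists>S \<subseteq> carrier M. finite S \<and> card S = n \<and> \<not> module.lin_dep R M S) \<longleftrightarrow>
      (\<exists>S \<subseteq> carrier N. finite S \<and> card S = n \<and> \<not> module.lin_dep R N S)" for n
    using transfer[OF M N iso] transfer[OF N M modules_isomorphic_sym[OF M iso]] by blast
  then show ?thesis by (simp add: module_rank_def)
qed

section \<open>The rank of a standard lattice\<close>

context quadratic_conjugation
begin

lemma lincomb_coord_module:
  fixes S :: "(nat \<Rightarrow> 'k) set"
  assumes S: "integral_submodule S" and W: "finite W" "W \<subseteq> S" and a: "\<And>v. v \<in> W \<Longrightarrow> algebraic_int (a v)"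
  shows "module.lincomb (coord_module S) a W = (\<lambda>i. \<Sum>v\<in>W. a v * v i)"
proof -
  interpret module ring_of_integers "coord_module S" by (rule coord_module_module[OF S])
  show ?thesis
    unfolding lincomb_def using W a
  proof (induction W rule: finite_induct)
    case empty
    then show ?case by (simp add: zero_fun_def)
  next
    case (insert v W)
    then have "(\<lambda>v i. a v * v i) \<in> W \<rightarrow> carrier (coord_module S)" "(\<lambda>i. a v * v i) \<in> carrier (coord_module S)"
      using integral_submodule_smult[OF S] by auto
    then show ?case using insert by (simp add: fun_eq_iff)
  qed
qed

lemma common_denominator:
  assumes "finite X"
  obtains m :: int where "m \<noteq> 0" "\<And>x. x \<in> X \<Longrightarrow> algebraic_int (of_int m * x :: 'k)"
  using assms
proof (induction X arbitrary: thesis rule: finite_induct)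
  case empty
  then show ?case using empty[of 1] by simp
next
  case (insert y X)
  obtain m where m: "m \<noteq> 0" "\<And>x. x \<in> X \<Longrightarrow> algebraic_int (of_int m * x)"
    using insert.IH by blast
  obtain n where n: "n \<noteq> 0" "algebraic_int (of_int n * y)"
    using integral_of_int_multiple by blast
  have "algebraic_int (of_int (m * n) * x)" if "x \<in> insert y X" for x
  proof (cases "x = y")
    case True
    then show ?thesis using integral_mult[OF _ n(2), of "of_int m"] by (simp add: mult.assoc)
  next
    case False
    then show ?thesis
      using integral_mult[OF _ m(2), of "of_int n" x] that by (simp add: mult_ac)
  qed
  then show ?case using insert.prems[of "m * n"] m n by simp
qed

text \<open>Of \<open>k + 2\<close> vectors the coordinates form a square matrix whose last row is
  zero, because coordinate \<open>Suc k\<close> vanishes on the lattice. Its determinant is 0, and a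
  kernel vector over \<open>K\<close> becomes an integral relation after clearing
  denominators.\<close>

lemma std_lattice_lin_dep:
  assumes A: "ideal A (ring_of_integers :: 'k ring)"
    and W: "W \<subseteq> std_lattice k A" "finite W" "card W > Suc k"
  shows "module.lin_dep ring_of_integers (coord_module (std_lattice k A)) W"
proof -
  note L = std_lattice_integral_submodule[OF A, of k]
  interpret module ring_of_integers "coord_module (std_lattice k A)" by (rule coord_module_module[OF L])
  let ?n = "Suc (Suc k)"
  obtain C where C: "C \<subseteq> W" "card C = ?n" "finite C"
    using W(3) by (metis Suc_leI obtain_subset_with_card_n)
  obtain h where h: "bij_betw h {0..<?n} C"
    using ex_bij_betw_nat_finite[OF C(3)] C(2) by auto
  define Y where "Y = mat ?n ?n (\<lambda>(i, j). h j i)"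
  have Y: "Y \<in> carrier_mat ?n ?n" by (simp add: Y_def)
  have hL: "h j \<in> std_lattice k A" if "j < ?n" for j
    using bij_betw_apply[OF h, of j] that C(1) W(1) by auto
  have "(\<Prod>i = 0..<?n. Y $$ (i, p i)) = 0" if p: "p permutes {0..<?n}" for p
  proof (rule prod_zero)
    have "p (Suc k) < ?n" using permutes_in_image[OF p, of "Suc k"] by simp
    then have "Y $$ (Suc k, p (Suc k)) = 0" using hL by (simp add: Y_def std_lattice_def)
    then show "\<exists>i\<in>{0..<?n}. Y $$ (i, p i) = 0" by (intro bexI[of _ "Suc k"]) auto
  qed simp
  then have "det Y = 0" unfolding det_def'[OF Y] by (intro sum.neutral) simp
  then obtain v where v: "v \<in> carrier_vec ?n" "v \<noteq> 0\<^sub>v ?n" "Y *\<^sub>v v = 0\<^sub>v ?n"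
    using det_0_iff_vec_prod_zero_field[OF Y] by blast
  obtain m :: int where m: "m \<noteq> 0" "\<And>x. x \<in> (\<lambda>j. v $ j) ` {0..<?n} \<Longrightarrow> algebraic_int (of_int m * x)"
    using common_denominator[of "(\<lambda>j. v $ j) ` {0..<?n}"] by blast
  define h' where "h' = inv_into {0..<?n} h"
  have h'h: "h' (h j) = j" if "j < ?n" for j
    using bij_betw_inv_into_left[OF h] that by (simp add: h'_def)
  define a where "a w = of_int m * v $ h' w" for w
  have aint: "algebraic_int (a w)" if "w \<in> C" for w
    using bij_betw_apply[OF bij_betw_inv_into[OF h] that] m(2) by (auto simp: a_def h'_def)
  have "(\<Sum>w\<in>C. a w * w i) = 0" for i
  proof (cases "i < ?n")
    case True
    have "(\<Sum>w\<in>C. a w * w i) = (\<Sum>j\<in>{0..<?n}. a (h j) * h j i)"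
      by (rule sum.reindex_bij_betw[OF h, symmetric])
    also have "\<dots> = of_int m * (\<Sum>j\<in>{0..<?n}. Y $$ (i, j) * v $ j)"
      unfolding sum_distrib_left using True
      by (intro sum.cong) (auto simp: a_def h'h Y_def)
    also have "(\<Sum>j\<in>{0..<?n}. Y $$ (i, j) * v $ j) = (Y *\<^sub>v v) $ i"
      using True v(1) Y by (simp add: scalar_prod_def del: sum.op_ivl_Suc)
    also have "\<dots> = 0" using True v(3) by simp
    finally show ?thesis by simp
  next
    case False
    then have "w i = 0" if "w \<in> C" for w using that C(1) W(1) by (auto simp: std_lattice_def)
    then show ?thesis by (intro sum.neutral) simp
  qed
  then have "lincomb a C = \<zero>\<^bsub>coord_module (std_lattice k A)\<^esub>"
    using lincomb_coord_module[OF L C(3), of a] C(1) W(1) aint by (simp add: zero_fun_def subset_trans)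
  moreover obtain j where j: "j < ?n" "v $ j \<noteq> 0"
    using v by (metis carrier_vecD eq_vecI index_zero_vec)
  moreover have "h j \<in> C" using bij_betw_apply[OF h, of j] j by simp
  moreover have "a (h j) \<noteq> 0" using j m by (simp add: a_def h'h)
  ultimately show ?thesis
    using lin_dep_crit[of C W a "h j"] C aint by auto
qed

text \<open>The lower bound comes from the scaled unit vectors \<open>coord_vec a j\<close> with
  \<open>a\<close> in \<open>A\<close>, which all lie in the lattice.\<close>

lemma module_rank_std_lattice:
  assumes A: "ideal A (ring_of_integers :: 'k ring)" "A \<noteq> {0}"
  shows "module_rank ring_of_integers (coord_module (std_lattice k A)) = Suc k"
  unfolding module_rank_def
proof (rule Greatest_equality)
  note L = std_lattice_integral_submodule[OF A(1), of k]
  interpret module ring_of_integers "coord_module (std_lattice k A)" by (rule coord_module_module[OF L])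
  obtain a where a: "a \<in> A" "a \<noteq> 0" using A ideal_zero by blast
  let ?E = "coord_vec a ` {..k}"
  have EL: "?E \<subseteq> std_lattice k A"
    using ideal_zero[OF A(1)] ideal_integral[OF A(1)] a by (auto intro!: coord_vec_std_lattice)
  have inj: "inj_on (coord_vec a) {..k}"
    using a by (auto simp: inj_on_def coord_vec_def fun_eq_iff split: if_splits)
  have "lin_indpt ?E"
  proof (rule finite_lin_indpt2)
    fix c assume c: "c \<in> ?E \<rightarrow> carrier ring_of_integers"
      and "lincomb c ?E = \<zero>\<^bsub>coord_module (std_lattice k A)\<^esub>"
    then have "(\<lambda>i. \<Sum>v\<in>?E. c v * v i) = 0"
      using lincomb_coord_module[OF L _ EL, of c] by (auto simp: Pi_iff)
    from fun_cong[OF this] have *: "(\<Sum>v\<in>?E. c v * v i) = 0" for i by simp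
    have "c (coord_vec a j) = 0" if "j \<le> k" for j
    proof -
      have "0 = (\<Sum>l\<le>k. c (coord_vec a l) * coord_vec a l j)"
        using *[of j] sum.reindex[OF inj, of "\<lambda>v. c v * v j"] by simp
      also have "\<dots> = (\<Sum>l\<in>{j}. c (coord_vec a l) * coord_vec a l j)"
        using that by (intro sum.mono_neutral_right) (auto simp: coord_vec_def)
      finally show ?thesis using a by (simp add: coord_vec_def)
    qed
    then show "\<forall>v\<in>?E. c v = \<zero>\<^bsub>ring_of_integers\<^esub>" by auto
  qed (use EL in auto)
  then show "\<exists>S\<subseteq>carrier (coord_module (std_lattice k A)). finite S \<and> card S = Suc k \<and> lin_indpt S"
    using EL card_image[OF inj] by (intro exI[of _ ?E]) auto
  fix n assume "\<exists>S\<subseteq>carrier (coord_module (std_lattice k A)). finite S \<and> card S = n \<and> lin_indpt S"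
  then show "n \<le> Suc k" using std_lattice_lin_dep[OF A(1)] not_less by auto
qed

end

section \<open>Finite index submodules of free modules\<close>

text \<open>Links the lattices with the decomposition that defines Steinitz ideals; \<open>T\<close>
  is a one-element summand, to be filled by the torsion of a torsion-free module.\<close>

lemma direct_sum_std_lattice_iso:
  assumes T: "carrier T = {\<zero>\<^bsub>T\<^esub>}" "\<zero>\<^bsub>T\<^esub> \<oplus>\<^bsub>T\<^esub> \<zero>\<^bsub>T\<^esub> = \<zero>\<^bsub>T\<^esub>"
    "\<And>c. c \<in> carrier ring_of_integers \<Longrightarrow> c \<odot>\<^bsub>T\<^esub> \<zero>\<^bsub>T\<^esub> = \<zero>\<^bsub>T\<^esub>"
    and R: "ring (ring_of_integers :: 'k::field_char_0 ring)"
  shows "modules_isomorphic ring_of_integers (coord_module (std_lattice k (A :: 'k set)))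
    (direct_sum T (direct_sum (ring.func_space ring_of_integers {..<k}) (ideal_module ring_of_integers A)))"
    (is "modules_isomorphic _ _ ?D")
proof -
  interpret ring "ring_of_integers :: 'k ring" by fact
  \<comment> \<open>Elements of \<open>func_space\<close> are extensional, hence
    \<open>restrict\<close>.\<close>
  define f where "f x = (\<zero>\<^bsub>T\<^esub>, restrict x {..<k}, x k)" for x :: "nat \<Rightarrow> 'k"
  have "bij_betw f (std_lattice k A) (carrier ?D)"
  proof (rule bij_betw_byWitness[where f' = "\<lambda>(t, u, a) i. if i < k then u i else if i = k then a else 0"])
    show "\<forall>x\<in>std_lattice k A. (case f x of (t, u, a) \<Rightarrow> \<lambda>i. if i < k then u i else if i = k then a else 0) = x"
      by (auto simp: f_def std_lattice_def fun_eq_iff)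
    show "\<forall>y\<in>carrier ?D. f (case y of (t, u, a) \<Rightarrow> \<lambda>i. if i < k then u i else if i = k then a else 0) = y"
      by (auto simp: f_def direct_sum_def func_space_def ideal_module_def T(1) fun_eq_iff PiE_def extensional_def)
    show "f ` std_lattice k A \<subseteq> carrier ?D"
      by (auto simp: f_def direct_sum_def func_space_def ideal_module_def T(1) std_lattice_def split: if_splits)
    show "(\<lambda>(t, u, a) i. if i < k then u i else if i = k then a else 0) ` carrier ?D \<subseteq> std_lattice k A"
      by (auto simp: direct_sum_def func_space_def ideal_module_def std_lattice_def PiE_def Pi_def)
  qed
  moreover have "f \<in> module_hom ring_of_integers (coord_module (std_lattice k A)) ?D"
    unfolding module_hom_def
  proof (intro CollectI conjI allI impI funcsetI)
    show "f x \<in> carrier ?D" if "x \<in> carrier (coord_module (std_lattice k A))" for x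
      using bij_betw_apply[OF calculation] that by simp
  qed (auto simp: f_def direct_sum_def func_space_def ideal_module_def T(2,3))
  ultimately show ?thesis by (auto simp: modules_isomorphic_def)
qed

section \<open>Coordinates, norms and Steinitz classes\<close>

context quadratic_conjugation
begin

lemma ideal_norm_eq_card_transversal:
  assumes A: "ideal A (ring_of_integers :: 'k ring)" and U: "transversal {x. algebraic_int x} A U"
  shows "ideal_norm A = card U"
proof -
  interpret O: cring "ring_of_integers :: 'k ring" by (rule integers_cring)
  interpret A: ideal A "ring_of_integers :: 'k ring" by (rule A)
  have "{x. algebraic_int x \<and> x \<in> A} = A" using ideal_integral[OF A] by blast
  then have "transversal {x. algebraic_int x} {x \<in> {x. algebraic_int x}. x \<in> A} U" using U by simp
  then have "bij_betw (\<lambda>t. A +>\<^bsub>ring_of_integers\<^esub> t) U (a_rcosets\<^bsub>ring_of_integers\<^esub> A)"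
    by (intro bij_betw_a_rcosets[where \<psi> = "\<lambda>x. x", OF O.abelian_group_axioms A.additive_subgroup_axioms
        _ integers_additive]) (auto simp: bij_betw_def)
  then show ?thesis by (simp add: ideal_norm_def FactRing_def bij_betw_same_card)
qed

text \<open>An enumeration of the basis provides the coordinates. The basis must be nonempty because
  \<open>std_lattice k\<close> has \<open>k + 1\<close> of them.\<close>

lemma free_module_coordinates:
  assumes L: "module (ring_of_integers :: 'k ring) L" and B: "B \<subseteq> carrier L" "finite B" "card B = Suc k"
    and li: "\<not> module.lin_dep ring_of_integers L B" and gen: "module.span ring_of_integers L B = carrier L"
  obtains \<psi> where "\<psi> \<in> module_hom ring_of_integers (coord_module (std_lattice k {x. algebraic_int x})) L"
    "bij_betw \<psi> (std_lattice k {x. algebraic_int x}) (carrier L)"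
proof -
  interpret L: module "ring_of_integers :: 'k ring" L by fact
  let ?X = "std_lattice k {x :: 'k. algebraic_int x}"
  note X = integral_submodule_additive[OF std_lattice_integral_submodule[OF ideal_integers, of k]]
  obtain h where h: "bij_betw h {0..<Suc k} B"
    using ex_bij_betw_nat_finite[OF B(2)] B(3) by auto
  define h' where "h' = inv_into {0..<Suc k} h"
  have h'k: "h' v \<le> k" and hh': "h (h' v) = v" if "v \<in> B" for v
    using bij_betw_apply[OF bij_betw_inv_into[OF h] that] bij_betw_inv_into_right[OF h that]
    by (simp_all add: h'_def)
  have h'h: "h' (h i) = i" "h i \<in> B" if "i \<le> k" for i
    using bij_betw_inv_into_left[OF h, of i] bij_betw_apply[OF h, of i] that by (simp_all add: h'_def)
  define \<psi> where "\<psi> x = L.lincomb (\<lambda>v. x (h' v)) B" for x :: "nat \<Rightarrow> 'k"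
  have int: "algebraic_int (x i)" if "x \<in> ?X" "i \<le> k" for x i
    using that by (cases "i = k") (auto simp: std_lattice_def)
  have co: "(\<lambda>v. x (h' v)) \<in> B \<rightarrow> carrier ring_of_integers" if "x \<in> ?X" for x
    using int[OF that] h'k by auto
  have closed: "\<psi> x \<in> carrier L" if "x \<in> ?X" for x
    unfolding \<psi>_def using L.lincomb_closed[OF B(1) co[OF that]] .
  have add: "\<psi> (x + y) = \<psi> x \<oplus>\<^bsub>L\<^esub> \<psi> y" if "x \<in> ?X" "y \<in> ?X" for x y
    using L.lincomb_sum[OF B(2,1) co[OF that(1)] co[OF that(2)]] by (simp add: \<psi>_def)
  have smult: "\<psi> (\<lambda>i. c * x i) = c \<odot>\<^bsub>L\<^esub> \<psi> x" if "x \<in> ?X" "algebraic_int c" for c x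
    using L.lincomb_smult[OF B(1) co[OF that(1)], of c] that(2) by (simp add: \<psi>_def)
  have kernel: "x = 0" if x: "x \<in> ?X" "\<psi> x = \<zero>\<^bsub>L\<^esub>" for x
  proof
    fix i
    show "x i = 0 i"
    proof (cases "i \<le> k")
      case True
      show ?thesis
      proof (rule ccontr)
        assume "x i \<noteq> 0 i"
        then have "L.lin_dep B"
          using x(2) h'h[OF True]
          by (intro L.lin_dep_crit[OF B(2) order_refl co[OF x(1)], of "h i"]) (auto simp: \<psi>_def)
        then show False using li by simp
      qed
    qed (use x(1) in \<open>simp add: std_lattice_def\<close>)
  qed
  have "inj_on \<psi> ?X"
  proof (rule inj_onI)
    fix x y assume xy: "x \<in> ?X" "y \<in> ?X" "\<psi> x = \<psi> y"
    have d: "x - y \<in> ?X" using additive_subset_diff[OF X] xy by blast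
    have "\<psi> (x - y) \<oplus>\<^bsub>L\<^esub> \<psi> y = \<zero>\<^bsub>L\<^esub> \<oplus>\<^bsub>L\<^esub> \<psi> y"
      using add[OF d xy(2)] xy(3) closed[OF xy(2)] by simp
    then have "\<psi> (x - y) = \<zero>\<^bsub>L\<^esub>"
      using L.M.add.right_cancel closed[OF d] closed[OF xy(2)] by blast
    then show "x = y" using kernel[OF d] by simp
  qed
  moreover have "\<psi> ` ?X = carrier L"
  proof (intro equalityI subsetI)
    fix v assume "v \<in> carrier L"
    then obtain a where a: "a \<in> B \<rightarrow> carrier ring_of_integers" "L.lincomb a B = v"
      using L.finite_in_span[OF B(2,1)] gen by blast
    define x where "x i = (if i \<le> k then a (h i) else 0)" for i
    have ai: "algebraic_int (a w)" if "w \<in> B" for w using a(1) that by auto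
    have "x \<in> ?X" using ai h'h(2) by (auto simp: x_def std_lattice_def)
    moreover have "\<psi> x = L.lincomb a B"
      unfolding \<psi>_def using h'k hh' by (intro L.lincomb_cong[OF refl B(1) _ a(1)]) (simp add: x_def)
    ultimately show "v \<in> \<psi> ` ?X" using a(2) by (metis imageI)
  qed (use closed in auto)
  ultimately have "bij_betw \<psi> ?X (carrier L)" by (simp add: bij_betw_def)
  moreover have "\<psi> \<in> module_hom ring_of_integers (coord_module ?X) L"
    using closed add smult by (auto simp: module_hom_def)
  ultimately show ?thesis using that by blast
qed

text \<open>An isomorphic copy lies in a vector space over \<open>K\<close>, where nonzero scalars
  are cancellable.\<close>

lemma torsion_submodule_trivial:
  assumes N: "module (ring_of_integers :: 'k ring) N"
    and iso: "modules_isomorphic ring_of_integers N (coord_module S)"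
  shows "carrier (torsion_submodule ring_of_integers N) = {\<zero>\<^bsub>N\<^esub>}"
proof -
  interpret N: module "ring_of_integers :: 'k ring" N by fact
  obtain f where f: "f \<in> module_hom ring_of_integers N (coord_module S)" "bij_betw f (carrier N) S"
    using iso by (auto simp: modules_isomorphic_def)
  have f0: "f \<zero>\<^bsub>N\<^esub> = 0"
    using module_hom_add[OF f(1), of "\<zero>\<^bsub>N\<^esub>" "\<zero>\<^bsub>N\<^esub>"] by simp
  have "x = \<zero>\<^bsub>N\<^esub>" if x: "x \<in> carrier N" and r: "algebraic_int r" "r \<noteq> 0" "r \<odot>\<^bsub>N\<^esub> x = \<zero>\<^bsub>N\<^esub>" for x r
  proof -
    have "(\<lambda>i. r * f x i) = 0" using module_hom_smult[OF f(1), of r x] f0 x r by simp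
    then have "f x = f \<zero>\<^bsub>N\<^esub>" using r(2) f0 by (simp add: fun_eq_iff)
    then show ?thesis using f(2) x unfolding bij_betw_def by (meson N.M.zero_closed inj_onD)
  qed
  then show ?thesis
    by (auto simp: torsion_submodule_def intro: exI[of _ 1])
qed

text \<open>The class is a definite description, so both halves are needed: \<open>A\<close> is a
  Steinitz ideal, and any other one gives an isomorphic lattice with the same \<open>k\<close>,
  hence the same class. The rank \<open>Suc k\<close> makes the exponent
  \<open>module_rank - 1\<close> equal to \<open>k\<close>.\<close>

lemma steinitz_class_eq:
  fixes N :: "('k, 'b, 'n) module_scheme"
  assumes N: "module (ring_of_integers :: 'k ring) N"
    and A: "ideal A (ring_of_integers :: 'k ring)" "A \<noteq> {0}"
    and iso: "modules_isomorphic ring_of_integers N (coord_module (std_lattice k A))"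
  shows "steinitz_class N = ideal_class A"
proof -
  interpret O: cring "ring_of_integers :: 'k ring" by (rule integers_cring)
  interpret N: module "ring_of_integers :: 'k ring" N by fact
  have modA: "module ring_of_integers (coord_module (std_lattice k C))"
    if "ideal C (ring_of_integers :: 'k ring)" for C
    by (rule coord_module_module[OF std_lattice_integral_submodule[OF that]])
  have rank: "module_rank ring_of_integers N = Suc k"
    using module_rank_iso[OF N modA[OF A(1)] iso] module_rank_std_lattice[OF A] by simp
  have D: "modules_isomorphic ring_of_integers (coord_module (std_lattice k C))
      (direct_sum (torsion_submodule ring_of_integers N)
        (direct_sum (ring.func_space ring_of_integers {..<k}) (ideal_module ring_of_integers C)))" for C
    using torsion_submodule_trivial[OF N iso]
    by (intro direct_sum_std_lattice_iso O.ring_axioms) (auto simp: torsion_submodule_def)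
  have "steinitz_ideal N A"
    using A modules_isomorphic_trans[OF iso D] by (simp add: steinitz_ideal_def rank)
  moreover have "ideal_class C = ideal_class A" if "steinitz_ideal N C" for C
  proof -
    have C: "ideal C (ring_of_integers :: 'k ring)" "C \<noteq> {0}"
      and isoC: "modules_isomorphic ring_of_integers N
      (direct_sum (torsion_submodule ring_of_integers N)
        (direct_sum (ring.func_space ring_of_integers {..<k}) (ideal_module ring_of_integers C)))"
      using that by (simp_all add: steinitz_ideal_def rank)
    have "modules_isomorphic ring_of_integers (coord_module (std_lattice k A)) (coord_module (std_lattice k C))"
      using modules_isomorphic_trans[OF modules_isomorphic_sym[OF N iso]
          modules_isomorphic_trans[OF isoC modules_isomorphic_sym[OF modA[OF C(1)] D]]] .
    then show ?thesis using std_lattice_iso_imp_ideal_class_eq[OF A C] by simp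
  qed
  ultimately have "(THE C. \<exists>A. steinitz_ideal N A \<and> C = ideal_class A) = ideal_class A"
    by (intro the_equality) (blast, metis)
  then show ?thesis by (simp add: steinitz_class_def rank)
qed

text \<open>The zero vector is linearly dependent because \<open>1 \<noteq> 0\<close>, so only the
  empty set is independent and the rank is 0.\<close>

lemma steinitz_class_trivial:
  assumes N: "module (ring_of_integers :: 'k ring) N" and carr: "carrier N = {\<zero>\<^bsub>N\<^esub>}"
  shows "steinitz_class N = ideal_class {x :: 'k. algebraic_int x}"
proof -
  interpret N: module "ring_of_integers :: 'k ring" N by fact
  have "module_rank ring_of_integers N = 0"
    unfolding module_rank_def
  proof (rule Greatest_equality)
    show "\<exists>S\<subseteq>carrier N. finite S \<and> card S = 0 \<and> N.lin_indpt S"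
      by (intro exI[of _ "{}"]) (simp add: N.lin_dep_def)
  next
    fix n assume "\<exists>S\<subseteq>carrier N. finite S \<and> card S = n \<and> N.lin_indpt S"
    then obtain S where S: "S \<subseteq> {\<zero>\<^bsub>N\<^esub>}" "card S = n" "N.lin_indpt S" using carr by blast
    have "(1 :: 'k) \<in> carrier ring_of_integers" "(1 :: 'k) \<notin> {\<zero>\<^bsub>ring_of_integers\<^esub>}" by simp_all
    then have "\<zero>\<^bsub>N\<^esub> \<notin> S"
      using N.zero_lin_dep[of S] S(3) by blast
    then have "S = {}" using S(1) by blast
    then show "n \<le> 0" using S(2) by simp
  qed
  then show ?thesis by (simp add: steinitz_class_def)
qed

lemma steinitz_class_finite_index_submodule:
  fixes L :: "('k, 'b, 'n) module_scheme"
  assumes L: "module (ring_of_integers :: 'k ring) L" and free: "free_of_finite_rank ring_of_integers L"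
    and M: "submodule ring_of_integers M L" and fin: "finite (a_rcosets\<^bsub>L\<^esub> M)"
  shows "\<exists>A. ideal A ring_of_integers \<and> A \<noteq> {0} \<and>
    ideal_class A = steinitz_class (L\<lparr>carrier := M\<rparr>) \<and> ideal_norm A = card (a_rcosets\<^bsub>L\<^esub> M)"
proof -
  interpret L: module "ring_of_integers :: 'k ring" L by fact
  interpret sub: submodule "ring_of_integers :: 'k ring" M L by fact
  let ?N = "L\<lparr>carrier := M\<rparr>"
  have N: "module ring_of_integers ?N" by (rule L.submodule_is_module[OF M])
  \<comment> \<open>Negatives stay in \<open>M\<close> because they are multiples by the integral
    scalar -1.\<close>
  have Madd: "additive_subgroup M L"
  proof (rule additive_subgroup.intro, rule L.add.subgroupI)
    fix x assume x: "x \<in> M"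
    then have "(- 1) \<odot>\<^bsub>L\<^esub> x \<in> M" by (intro sub.smult_closed) auto
    moreover have "(- 1) \<odot>\<^bsub>L\<^esub> x = \<ominus>\<^bsub>L\<^esub> x"
    proof -
      have xL: "x \<in> carrier L" using x sub.subset by blast
      have "(- 1) \<odot>\<^bsub>L\<^esub> x \<oplus>\<^bsub>L\<^esub> x = ((- 1) \<oplus>\<^bsub>ring_of_integers\<^esub> 1) \<odot>\<^bsub>L\<^esub> x"
        using L.smult_l_distr[of "- 1" 1 x] L.smult_one[OF xL] xL by simp
      also have "\<dots> = \<zero>\<^bsub>L\<^esub>" using L.smult_l_null[OF xL] by simp
      finally show ?thesis using L.M.minus_equality[of "(- 1) \<odot>\<^bsub>L\<^esub> x" x] xL by simp
    qed
    ultimately show "\<ominus>\<^bsub>L\<^esub> x \<in> M" by simp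
  next
    show "M \<noteq> {}" using sub.zero_closed by blast
  qed (use sub.subset in auto)
  obtain B where B: "B \<subseteq> carrier L" "finite B" "L.lin_indpt B" "L.gen_set B"
    using free by (auto simp: free_of_finite_rank_def)
  show ?thesis
  proof (cases "card B")
    case 0
    then have "B = {}" using B(2) by simp
    then have L0: "carrier L = {\<zero>\<^bsub>L\<^esub>}"
      using L.finite_span[OF B(2,1)] B(4) by (auto simp: L.lincomb_def)
    then have M0: "M = {\<zero>\<^bsub>L\<^esub>}" using sub.subset sub.zero_closed by blast
    let ?O = "{x :: 'k. algebraic_int x}"
    have "transversal ?O ?O {0}"
      by (rule transversalI[OF integers_additive]) auto
    then have "ideal_norm ?O = 1"
      using ideal_norm_eq_card_transversal[OF ideal_integers] by simp
    moreover have "card (a_rcosets\<^bsub>L\<^esub> M) = 1"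
    proof -
      \<comment> \<open>The zero module is outside the scope of the standard lattices; its single
        coset is counted by the constant map from a one-element group.\<close>
      have "transversal {0 :: 'k} {x \<in> {0 :: 'k}. \<zero>\<^bsub>L\<^esub> \<in> M} {0}"
        using sub.zero_closed by (auto simp: transversal_def)
      then have "bij_betw (\<lambda>t. M +>\<^bsub>L\<^esub> \<zero>\<^bsub>L\<^esub>) {0 :: 'k} (a_rcosets\<^bsub>L\<^esub> M)"
        using L0 by (intro bij_betw_a_rcosets[OF L.M.abelian_group_axioms Madd])
          (auto simp: bij_betw_def additive_subset_def)
      then show ?thesis using bij_betw_same_card by fastforce
    qed
    moreover have "?O \<noteq> {0}" using algebraic_int_1 by (metis mem_Collect_eq singletonD one_neq_zero)
    moreover have "steinitz_class ?N = ideal_class ?O"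
      using steinitz_class_trivial[OF N] M0 by simp
    ultimately show ?thesis using ideal_integers by (intro exI[of _ ?O]) simp
  next
    case (Suc k)
    let ?X = "std_lattice k {x :: 'k. algebraic_int x}"
    obtain \<psi> where \<psi>: "\<psi> \<in> module_hom ring_of_integers (coord_module ?X) L" "bij_betw \<psi> ?X (carrier L)"
      using free_module_coordinates[OF L B(1,2) Suc B(3,4)] by blast
    note X = std_lattice_integral_submodule[OF ideal_integers, of k]
    have add: "\<psi> (x + y) = \<psi> x \<oplus>\<^bsub>L\<^esub> \<psi> y" if "x \<in> ?X" "y \<in> ?X" for x y
      using module_hom_add[OF \<psi>(1), of x y] that by simp
    have smult: "\<psi> (\<lambda>i. c * x i) = c \<odot>\<^bsub>L\<^esub> \<psi> x" if "x \<in> ?X" "algebraic_int c" for c x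
      using module_hom_smult[OF \<psi>(1), of c x] that by simp
    \<comment> \<open>The lattice of coordinates of \<open>M\<close>: its index in \<open>?X\<close>
      is that of \<open>M\<close> in \<open>L\<close>, and \<psi> restricts to an isomorphism from
      it onto \<open>M\<close>.\<close>
    define S where "S = {x \<in> ?X. \<psi> x \<in> M}"
    have S: "integral_submodule S" "S \<subseteq> ?X"
    proof -
      have "\<psi> (\<lambda>i. 0 * (0 :: nat \<Rightarrow> 'k) i) = 0 \<odot>\<^bsub>L\<^esub> \<psi> 0"
        using smult[OF integral_submodule_zero[OF X], of 0] by simp
      moreover have "\<psi> 0 \<in> carrier L"
        using bij_betw_apply[OF \<psi>(2) integral_submodule_zero[OF X]] .
      ultimately have "\<psi> 0 = \<zero>\<^bsub>L\<^esub>" using L.smult_l_null by (simp add: zero_fun_def)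
      then show "integral_submodule S"
        unfolding integral_submodule_def S_def
        using X add smult sub.zero_closed by (auto simp: integral_submodule_def)
      show "S \<subseteq> ?X" by (auto simp: S_def)
    qed
    obtain T where T: "transversal ?X S T"
      using transversal_exists[OF integral_submodule_additive[OF S(1)]] by blast
    have bijT: "bij_betw (\<lambda>t. M +>\<^bsub>L\<^esub> \<psi> t) T (a_rcosets\<^bsub>L\<^esub> M)"
      using T add
      by (intro bij_betw_a_rcosets[OF L.M.abelian_group_axioms Madd \<psi>(2)
          integral_submodule_additive[OF X]]) (simp_all add: S_def)
    then have "finite T" using fin bij_betw_finite by blast
    then obtain A U where A: "ideal A (ring_of_integers :: 'k ring)" "A \<noteq> {0}"
      and iso: "modules_isomorphic ring_of_integers (coord_module S) (coord_module (std_lattice k A))"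
      and U: "transversal {x. algebraic_int x} A U" "card U = card T"
      using lattice_steinitz_form[OF S T] by blast
    have "bij_betw \<psi> S M"
    proof -
      have "inj_on \<psi> S" using \<psi>(2) S(2) by (auto simp: bij_betw_def intro: inj_on_subset)
      moreover have "\<psi> ` S = M"
        using \<psi>(2) sub.subset by (auto simp: S_def bij_betw_def)
      ultimately show ?thesis by (simp add: bij_betw_def)
    qed
    moreover have "\<psi> \<in> module_hom ring_of_integers (coord_module S) ?N"
      using add smult S(2) by (auto simp: module_hom_def S_def)
    ultimately have "modules_isomorphic ring_of_integers (coord_module S) ?N"
      by (auto simp: modules_isomorphic_def)
    then have "modules_isomorphic ring_of_integers ?N (coord_module (std_lattice k A))"
      using modules_isomorphic_trans[OF modules_isomorphic_sym[OF coord_module_module[OF S(1)]] iso] by blast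
    then have "steinitz_class ?N = ideal_class A" by (rule steinitz_class_eq[OF N A])
    moreover have "ideal_norm A = card (a_rcosets\<^bsub>L\<^esub> M)"
      using ideal_norm_eq_card_transversal[OF A(1) U(1)] U(2) bij_betw_same_card[OF bijT] by simp
    ultimately show ?thesis using A by auto
  qed
qed

end

theorem theorem2:
  fixes L :: "('k::field_char_0, 'b) module" and M :: "'b set"
  assumes "imaginary_quadratic_field TYPE('k)"
    and "module ring_of_integers L"
    and "free_of_finite_rank ring_of_integers L"
    and "submodule ring_of_integers M L"
    and "finite (a_rcosets\<^bsub>L\<^esub> M)"
  shows "\<exists>A. ideal A ring_of_integers \<and> A \<noteq> {0} \<and>
           ideal_class A = steinitz_class (L\<lparr>carrier := M\<rparr>) \<and>
           ideal_norm A = card (a_rcosets\<^bsub>L\<^esub> M)"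
proof -
  have "cring (ring_of_integers :: 'k ring)" using assms(2) by (simp add: module_def)
  then obtain \<sigma> and \<delta> :: 'k where "quadratic_conjugation \<sigma> \<delta>"
    using assms(1) quadratic_conjugation_exists unfolding imaginary_quadratic_field_def by blast
  then interpret quadratic_conjugation \<sigma> \<delta> .
  show ?thesis using steinitz_class_finite_index_submodule[OF assms(2-5)] .
qed

end
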